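(* Let $f,g\in\mathbb{R}[x,y]$ be nonzero polynomials and let $F_{f,g}:=\frac{\partial f}{\partial x}\frac{\partial g}{\partial y}-\frac{\partial f}{\partial y}\frac{\partial g}{\partial x}$. Assume that $g$ has an isolated zero at the origin and that the polynomials $f$, $g$ and $F_{f,g}$ are $y$-regular. Let $$\mathrm{MIN}:=\min_{\substack{*\in\{+,-\}\\ \gamma\in\mathbf{P}^{*}(F_{f,g})}}\ \lim_{x\to0^+}\frac{f( *x,\gamma(x))}{g( *x,\gamma(x))}\in\overline{\mathbb{R}},\qquad \mathrm{MAX}:=\max_{\substack{*\in\{+,-\}\\ \gamma\in\mathbf{P}^{*}(F_{f,g})}}\ \lim_{x\to0^+}\frac{f( *x,\gamma(x))}{g( *x,\gamma(x))}\in\overline{\mathbb{R}}.$$ Then $$\mathcal{R}_{f,g}=[\mathrm{MIN},\mathrm{MAX}].$$ In particular, if $\mathrm{MIN}=\mathrm{MAX}\in\mathbb{R}$, then the limit $\displaystyle\lim_{(x,y)\to(0,0)}\frac{f(x,y)}{g(x,y)}$ exists and is equal to this number.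
   Context: $\overline{\mathbb{R}}:=\mathbb{R}\cup\{\pm\infty\}$, and $[\mathrm{MIN},\mathrm{MAX}]$ is a closed interval in $\overline{\mathbb{R}}$. The (numerical) range of limits $\mathcal{R}_{f,g}$ is the set of $L\in\overline{\mathbb{R}}$ for which there is a sequence $(x_k,y_k)\to(0,0)$ in $\mathbb{R}^2$ (with $g(x_k,y_k)\neq0$) such that $\lim_{k\to\infty}\frac{f(x_k,y_k)}{g(x_k,y_k)}=L$. Order and $y$-regularity: for a nonzero polynomial $h=h_m+h_{m+1}+\cdots$ (homogeneous components, $h_m\not\equiv0$ of lowest degree $m$), $\operatorname{ord} h:=m$; $h$ is $y$-regular if $h_m(0,1)\neq0$ (in particular a $y$-regular polynomial is nonzero). Puiseux series: a Puiseux series is either $\varphi\equiv 0$ or $\varphi(x)=c_1x^{n_1/n}+c_2x^{n_2/n}+\cdots$ with $c_k\in\mathbb{C}$ and positive integers $n\le n_1<n_2<\cdots$ having no common divisor, such that the power series $\varphi(t^n)$ has positive radius of convergence. It is real if all $c_k$ are real. $\varphi$ is a Newton–Puiseux root of $h$ if $h(x,\varphi(x))\equiv0$; $\mathbf{P}(h)$ is the set of Newton–Puiseux roots of $h$. For $h\in\mathbb{R}[x,y]$, $\mathbf{P}^{+}(h):=\{\varphi\in\mathbf{P}(h):\varphi\text{ is real}\}$ and $\mathbf{P}^{-}(h):=\mathbf{P}^{+}(h(-x,y))$. The notation $*x$ means $x$ if $*=+$ and $-x$ if $*=-$. "$g$ has an isolated zero at the origin" means $g(0,0)=0$ and $g\neq0$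 at all other real points in some neighborhood of $(0,0)$ in $\mathbb{R}^2$. Limits are taken over points of $\mathbb{R}^2$ where $g\ne0$. *)

theory Defs
  imports "HOL-Analysis.Analysis" "HOL-Computational_Algebra.Computational_Algebra"
begin

text \<open>
  A bivariate polynomial \<open>h(x,y)\<close> is an element of \<open>R[x][y]\<close>, i.e.\ of type \<open>'a poly poly\<close>:
  the outer variable is \<open>y\<close>, and the coefficient of \<open>x^i y^j\<close> is \<open>coeff (coeff h j) i\<close>.
\<close>

definition bipoly :: "'a::comm_ring_1 poly poly \<Rightarrow> 'a \<Rightarrow> 'a \<Rightarrow> 'a" where
  "bipoly h x y = poly (poly h [:y:]) x"

definition dx :: "real poly poly \<Rightarrow> real poly poly" where
  "dx h = map_poly pderiv h"

definition dy :: "real poly poly \<Rightarrow> real poly poly" where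
  "dy h = pderiv h"

definition jacobian_poly :: "real poly poly \<Rightarrow> real poly poly \<Rightarrow> real poly poly" where
  "jacobian_poly f g = dx f * dy g - dy f * dx g"

definition reflect_x :: "real poly poly \<Rightarrow> real poly poly" where
  "reflect_x h = map_poly (\<lambda>p. pcompose p [:0, -1:]) h"

definition hom_component :: "nat \<Rightarrow> real poly poly \<Rightarrow> real poly poly" where
  "hom_component m h = (\<Sum>j\<le>m. monom (monom (coeff (coeff h j) (m - j)) (m - j)) j)"

definition bipoly_ord :: "real poly poly \<Rightarrow> nat" where
  "bipoly_ord h = (LEAST m. hom_component m h \<noteq> 0)"

definition y_regular :: "real poly poly \<Rightarrow> bool" where
  "y_regular h \<longleftrightarrow> h \<noteq> 0 \<and> bipoly (hom_component (bipoly_ord h) h) 0 1 \<noteq> 0"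

definition isolated_zero :: "real poly poly \<Rightarrow> bool" where
  "isolated_zero g \<longleftrightarrow> bipoly g 0 0 = 0 \<and>
     (\<forall>\<^sub>F (x, y) in at (0, 0). bipoly g x y \<noteq> 0)"

text \<open>
  A Puiseux series \<open>\<phi>(x) = c\<^sub>1 x^(n\<^sub>1/n) + c\<^sub>2 x^(n\<^sub>2/n) + \<dots>\<close> is encoded by the pair \<open>(n, \<psi>)\<close> where
  \<open>\<psi>(t) = \<phi>(t^n)\<close> is a formal power series. The divisor condition makes the pair unique;
  for \<open>\<psi> = 0\<close> it forces \<open>n = 1\<close>, so \<open>(1, 0)\<close> encodes \<open>\<phi> \<equiv> 0\<close>.
\<close>

definition puiseux_series :: "(nat \<times> complex fps) set" where
  "puiseux_series = {(n, \<psi>). n > 0 \<and> (\<forall>k<n. fps_nth \<psi> k = 0) \<and>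
     Gcd (insert n {k. fps_nth \<psi> k \<noteq> 0}) = 1 \<and> fps_conv_radius \<psi> > 0}"

definition real_puiseux :: "nat \<times> complex fps \<Rightarrow> bool" where
  "real_puiseux \<phi> \<longleftrightarrow> (\<forall>k. fps_nth (snd \<phi>) k \<in> \<real>)"

text \<open>The identity \<open>h(x, \<phi>(x)) \<equiv> 0\<close> is read after substituting \<open>x = t^n\<close>, as an identity of
  formal power series in \<open>t\<close>.\<close>

definition puiseux_roots :: "complex poly poly \<Rightarrow> (nat \<times> complex fps) set" where
  "puiseux_roots h = {(n, \<psi>) \<in> puiseux_series.
     bipoly (map_poly (map_poly fps_const) h) (fps_X ^ n) \<psi> = 0}"

definition P_plus :: "real poly poly \<Rightarrow> (nat \<times> complex fps) set" where
  "P_plus h = {\<phi> \<in> puiseux_roots (map_poly (map_poly complex_of_real) h). real_puiseux \<phi>}"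

definition P_minus :: "real poly poly \<Rightarrow> (nat \<times> complex fps) set" where
  "P_minus h = P_plus (reflect_x h)"

text \<open>The value \<open>\<gamma>(x) = \<psi>(x^(1/n))\<close> at small \<open>x > 0\<close>. It is used for real series only, where
  the evaluation is real and \<open>Re\<close> merely changes the type.\<close>

definition puiseux_eval :: "nat \<times> complex fps \<Rightarrow> real \<Rightarrow> real" where
  "puiseux_eval \<gamma> x = Re (eval_fps (snd \<gamma>) (complex_of_real (root (fst \<gamma>) x)))"

text \<open>The quotient \<open>f(*x, \<gamma>(x)) / g(*x, \<gamma>(x))\<close>, the sign \<open>*\<close> being given by \<open>s = 1\<close> or \<open>s = -1\<close>.\<close>

definition branch_quotient ::
  "real poly poly \<Rightarrow> real poly poly \<Rightarrow> real \<Rightarrow> nat \<times> complex fps \<Rightarrow> real \<Rightarrow> ereal" where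
  "branch_quotient f g s \<gamma> x =
     ereal (bipoly f (s * x) (puiseux_eval \<gamma> x) / bipoly g (s * x) (puiseux_eval \<gamma> x))"

definition branch_limit ::
  "real poly poly \<Rightarrow> real poly poly \<Rightarrow> real \<Rightarrow> nat \<times> complex fps \<Rightarrow> ereal" where
  "branch_limit f g s \<gamma> = Lim (at_right 0) (branch_quotient f g s \<gamma>)"

definition branch_limits :: "real poly poly \<Rightarrow> real poly poly \<Rightarrow> ereal set" where
  "branch_limits f g =
     branch_limit f g 1 ` P_plus (jacobian_poly f g) \<union> branch_limit f g (- 1) ` P_minus (jacobian_poly f g)"

definition MIN_limit :: "real poly poly \<Rightarrow> real poly poly \<Rightarrow> ereal" where
  "MIN_limit f g = Min (branch_limits f g)"

definition MAX_limit :: "real poly poly \<Rightarrow> real poly poly \<Rightarrow> ereal" where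
  "MAX_limit f g = Max (branch_limits f g)"

definition range_of_limits :: "real poly poly \<Rightarrow> real poly poly \<Rightarrow> ereal set" where
  "range_of_limits f g = {L. \<exists>x y :: nat \<Rightarrow> real.
     (\<lambda>k. (x k, y k)) \<longlonglongrightarrow> (0, 0) \<and> (\<forall>k. bipoly g (x k) (y k) \<noteq> 0) \<and>
     (\<lambda>k. ereal (bipoly f (x k) (y k) / bipoly g (x k) (y k))) \<longlonglongrightarrow> L}"

end

theory Submission
  imports Defs "HOL-Complex_Analysis.Complex_Analysis"
begin

text \<open>Near the origin the curves \<open>g = v\<close> are compact, and on each of them \<open>f\<close>, hence \<open>f/g\<close>, attains its
  extrema. As \<open>(f, g)\<close> is an open map wherever the Jacobian does not vanish, these extrema lie on the curve
  \<open>F = 0\<close>, \<open>F\<close> being the Jacobian. So every limit of \<open>f/g\<close> lies between two limits along sequences on \<open>F = 0\<close>. By the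
  Newton-Puiseux algorithm, run along a single sequence, some subsequence follows a real
  branch of \<open>F = 0\<close>, on which \<open>f/g\<close> is a quotient of analytic functions of \<open>x\<^sup>1\<^sup>/\<^sup>n\<close> and has a limit.
  Conversely, all values between two limits occur, because a punctured disc is connected.\<close>

text \<open>On a curve \<open>g = v\<close> the quotient is f/v, so only f has to be extremised. The
  obstacle is an extremum on the boundary of the disc; it is excluded by taking |v| below the
  minimum of |g| on the boundary circle. Openness of (f, g) replaces Lagrange multipliers, so the
  curve may be singular. Running the algorithm along a sequence of zeros avoids factoring F into all
  its Puiseux roots: at each stage compactness picks the root of the edge polynomial that a
  subsequence approaches. The branch obtained is at first only a complex analytic function of a root
  of x. That it belongs to \<open>P_plus\<close> is recovered afterwards: it shares points
  accumulating at 0 with the real zeros of F, so the identity theorem applies. Regularity of F in y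
  starts the algorithm, keeps critical points near the origin off the y-axis, and forces every
  branch to have order at least 1 in x, as the definition of a Puiseux series demands. Points with x
  < 0 are treated by reflecting x.\<close>

hide_const (open) Complex_Singularities.isolated_zero

section \<open>Analytic implicit functions and orders of vanishing\<close>

lemma norm_power_diff_le:
  fixes x y :: "'a::real_normed_field"
  assumes "norm x \<le> e" "norm y \<le> e"
  shows "norm (x ^ n - y ^ n) \<le> norm (x - y) * (real n * e ^ (n - 1))"
proof -
  have "norm (\<Sum>i<n. y ^ (n - Suc i) * x ^ i) \<le> (\<Sum>i<n. e ^ (n - 1))"
  proof (rule sum_norm_le)
    fix i assume "i \<in> {..<n}"
    then have "n - 1 = (n - Suc i) + i" by simp
    moreover have "0 \<le> e" using assms(1) norm_ge_zero order_trans by blast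
    ultimately show "norm (y ^ (n - Suc i) * x ^ i) \<le> e ^ (n - 1)"
      using assms by (auto simp: norm_mult norm_power power_add intro!: mult_mono power_mono)
  qed
  then show ?thesis
    by (simp add: power_diff_sumr2 norm_mult mult_left_mono)
qed

text \<open>Newton iteration with the slope frozen at the origin: \<open>T t y\<close> is y minus
  the polynomial in y divided by \<open>g 1 0\<close>. It is a contraction near 0, uniformly in t,
  and its iterates from 0 are holomorphic in t, so their uniform limit is holomorphic too.\<close>

lemma analytic_implicit_function:
  fixes g :: "nat \<Rightarrow> complex \<Rightarrow> complex"
  assumes an: "\<And>j. j \<le> d \<Longrightarrow> g j analytic_on {0}"
    and g0: "g 0 0 = 0" and g1: "g 1 0 \<noteq> 0" and d: "1 \<le> d"
  shows "\<exists>a. a analytic_on {0} \<and> a 0 = 0 \<and> (\<forall>\<^sub>F t in nhds 0. (\<Sum>j\<le>d. g j t * a t ^ j) = 0)"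
proof -
  define c where "c j t = (if j = 1 then 1 else 0) - g j t / g 1 0" for j t
  define T where "T t y = (\<Sum>j\<le>d. c j t * y ^ j)" for t y
  have T_eq: "T t y = y - (\<Sum>j\<le>d. g j t * y ^ j) / g 1 0" for t y
  proof -
    have "T t y = (\<Sum>j\<le>d. (if j = 1 then y ^ j else 0)) - (\<Sum>j\<le>d. g j t * y ^ j / g 1 0)"
      unfolding T_def c_def sum_subtractf[symmetric]
      by (intro sum.cong) (auto simp: algebra_simps)
    then show ?thesis using d by (simp add: sum_divide_distrib)
  qed
  have c_an: "c j analytic_on {0}" if "j \<le> d" for j
    unfolding c_def using an[OF that] g1 by (auto intro!: analytic_intros)
  have c00: "c 0 0 = 0" and c10: "c 1 0 = 0" using g0 g1 by (auto simp: c_def)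
  \<comment> \<open>\<open>E t e\<close> bounds the Lipschitz constant of \<open>T t\<close> on the
    disc of radius e. It vanishes at t = 0, e = 0 because \<open>c 1 0 = 0\<close>, so first a
    radius \<eta> for y and then a radius \<rho> for t can be chosen to make it smaller than
    1/2.\<close>
  define E where "E t e = (\<Sum>j\<le>d. norm (c j t) * (real j * e ^ (j - 1)))" for t e
  have "((\<lambda>e. E 0 e) \<longlongrightarrow> E 0 0) (at_right 0)"
    unfolding E_def by (intro tendsto_intros)
  moreover have "E 0 0 = 0"
    unfolding E_def
  proof (intro sum.neutral ballI)
    fix j assume "j \<in> {..d}"
    show "norm (c j 0) * (real j * 0 ^ (j - 1)) = 0"
      using c10 by (cases "j = 1"; cases "j = 0") auto
  qed
  ultimately have "\<forall>\<^sub>F e in at_right 0. E 0 e < 1/2"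
    by (metis half_gt_zero_iff order_tendstoD(2) zero_less_one)
  then have "\<forall>\<^sub>F e in at_right 0. 0 < e \<and> E 0 e < 1/2"
    using eventually_at_right_less[of "0::real"] by eventually_elim auto
  then obtain \<eta> where \<eta>: "\<eta> > 0" "E 0 \<eta> < 1/2"
    using eventually_happens'[OF trivial_limit_at_right_real] by blast
  have cont: "isCont (c j) 0" if "j \<le> d" for j
    using c_an[OF that] by (simp add: analytic_at_imp_isCont)
  have "((\<lambda>t. E t \<eta>) \<longlongrightarrow> E 0 \<eta>) (nhds 0)"
    unfolding E_def
    by (intro tendsto_intros) (use cont in \<open>auto simp: continuous_within tendsto_at_iff_tendsto_nhds\<close>)
  then have 1: "\<forall>\<^sub>F t in nhds 0. E t \<eta> < 1/2"
    using \<eta>(2) order_tendstoD(2) by blast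
  \<comment> \<open>Since \<open>T t 0 = c 0 t\<close>, this bound keeps the disc of radius \<eta>
    invariant: one half of \<eta> comes from the contraction, the other from the constant
    term.\<close>
  have "((\<lambda>t. norm (c 0 t)) \<longlongrightarrow> norm (c 0 0)) (nhds 0)"
    by (intro tendsto_intros) (use cont[of 0] in \<open>auto simp: continuous_within tendsto_at_iff_tendsto_nhds\<close>)
  then have 2: "\<forall>\<^sub>F t in nhds 0. norm (c 0 t) < \<eta> / 2"
    by (rule order_tendstoD(2)) (use \<eta>(1) c00 in simp)
  have "\<forall>\<^sub>F t in nhds 0. \<forall>j\<in>{..d}. c j analytic_on {t}"
  proof (intro eventually_ball_finite ballI)
    fix j assume "j \<in> {..d}"
    then obtain S where "open S" "0 \<in> S" "c j holomorphic_on S"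
      using c_an analytic_at by (metis atMost_iff)
    then show "\<forall>\<^sub>F t in nhds 0. c j analytic_on {t}"
      by (auto simp: analytic_at eventually_nhds)
  qed simp
  then have "\<forall>\<^sub>F t in nhds 0. E t \<eta> < 1/2 \<and> norm (c 0 t) < \<eta> / 2 \<and> (\<forall>j\<le>d. c j analytic_on {t})"
    using 1 2 by eventually_elim auto
  then obtain \<rho> where \<rho>: "\<rho> > 0" and *: "\<And>t. t \<in> ball 0 \<rho> \<Longrightarrow>
      E t \<eta> < 1/2 \<and> norm (c 0 t) < \<eta> / 2 \<and> (\<forall>j\<le>d. c j analytic_on {t})"
    unfolding eventually_nhds_metric by (auto simp: dist_commute)
  have hol: "c j holomorphic_on ball 0 \<rho>" if "j \<le> d" for j
    using * that by (meson analytic_imp_holomorphic analytic_on_analytic_at)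
  have lip: "norm (T t y - T t z) \<le> norm (y - z) / 2"
    if "t \<in> ball 0 \<rho>" "norm y \<le> \<eta>" "norm z \<le> \<eta>" for t y z
  proof -
    have "norm (T t y - T t z) = norm (\<Sum>j\<le>d. c j t * (y ^ j - z ^ j))"
      by (simp add: T_def sum_subtractf algebra_simps)
    also have "\<dots> \<le> (\<Sum>j\<le>d. norm (c j t) * (norm (y - z) * (real j * \<eta> ^ (j - 1))))"
      by (intro sum_norm_le) (use norm_power_diff_le that in \<open>auto simp: norm_mult intro!: mult_left_mono\<close>)
    also have "\<dots> = norm (y - z) * E t \<eta>"
      by (simp add: E_def sum_distrib_left algebra_simps)
    also have "\<dots> \<le> norm (y - z) * (1/2)"
      using * that(1) by (intro mult_left_mono) (auto simp: less_imp_le)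
    finally show ?thesis by simp
  qed
  have T0: "T t 0 = c 0 t" for t
    by (simp add: T_def power_0_left if_distrib cong: if_cong)
  define u where "u = rec_nat (\<lambda>_. 0) (\<lambda>_ v t. T t (v t))"
  have u0: "u 0 t = 0" and uS: "u (Suc n) t = T t (u n t)" for n t
    by (simp_all add: u_def)
  have ub: "norm (u n t) \<le> \<eta>" if "t \<in> ball 0 \<rho>" for n t
  proof (induction n)
    case 0
    then show ?case using \<eta> by (simp add: u0)
  next
    case (Suc n)
    have "norm (T t (u n t)) \<le> norm (T t (u n t) - T t 0) + norm (T t 0)"
      by (metis add.commute diff_add_cancel norm_triangle_ineq)
    also have "\<dots> \<le> norm (u n t) / 2 + \<eta> / 2"
      using lip[OF that Suc, of 0] * [OF that] \<eta> by (auto simp: T0)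
    finally show ?case using Suc by (simp add: uS)
  qed
  have ud: "norm (u (Suc n) t - u n t) \<le> \<eta> * (1/2) ^ n" if "t \<in> ball 0 \<rho>" for n t
  proof (induction n)
    case 0
    then show ?case using ub[OF that, of 1] by (simp add: u0)
  next
    case (Suc n)
    then show ?case using lip[OF that ub[OF that, of "Suc n"] ub[OF that, of n]]
      by (simp add: uS)
  qed
  \<comment> \<open>Writing the limit as a telescoping series lets the geometric decay of the
    increments give uniform convergence.\<close>
  define a where "a t = (\<Sum>i. u (Suc i) t - u i t)" for t
  have telesc: "(\<Sum>i<n. u (Suc i) t - u i t) = u n t" for n t
    by (induction n) (simp_all add: u0)
  have "uniform_limit (ball 0 \<rho>) (\<lambda>n t. \<Sum>i<n. u (Suc i) t - u i t) a sequentially"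
    unfolding a_def
    by (rule Weierstrass_m_test[OF ud]) (auto intro!: summable_mult summable_geometric)
  then have ul: "uniform_limit (ball 0 \<rho>) u a sequentially"
    unfolding telesc .
  have u_hol: "u n holomorphic_on ball 0 \<rho>" for n
  proof (induction n)
    case 0
    have "u 0 = (\<lambda>_. 0)" by (simp add: u0 fun_eq_iff)
    then show ?case by simp
  next
    case (Suc n)
    have "u (Suc n) = (\<lambda>t. \<Sum>j\<le>d. c j t * u n t ^ j)" by (simp add: uS T_def fun_eq_iff)
    then show ?case using Suc hol by (auto intro!: holomorphic_intros)
  qed
  have "a holomorphic_on ball 0 \<rho>"
  proof (rule holomorphic_uniform_sequence[OF open_ball u_hol])
    fix x :: complex assume "x \<in> ball 0 \<rho>"
    then obtain e where "e > 0" "cball x e \<subseteq> ball 0 \<rho>"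
      using open_contains_cball open_ball by blast
    then show "\<exists>d>0. cball x d \<subseteq> ball 0 \<rho> \<and> uniform_limit (cball x d) u a sequentially"
      using ul uniform_limit_on_subset by blast
  qed
  then have a_an: "a analytic_on {0}"
    using \<rho> by (metis analytic_at centre_in_ball open_ball)
  have lim: "(\<lambda>n. u n t) \<longlonglongrightarrow> a t" if "t \<in> ball 0 \<rho>" for t
    using tendsto_uniform_limitI[OF ul that] .
  have fp: "T t (a t) = a t" if "t \<in> ball 0 \<rho>" for t
  proof (rule LIMSEQ_unique)
    show "(\<lambda>n. u (Suc n) t) \<longlonglongrightarrow> a t" using lim[OF that] by (rule LIMSEQ_Suc)
    show "(\<lambda>n. u (Suc n) t) \<longlonglongrightarrow> T t (a t)"
      unfolding uS T_def by (intro tendsto_intros lim[OF that])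
  qed
  have "u n 0 = 0" for n
    by (induction n) (simp_all add: u0 uS T0 c00)
  then have "a 0 = 0"
    by (simp add: a_def)
  moreover have "\<forall>\<^sub>F t in nhds 0. (\<Sum>j\<le>d. g j t * a t ^ j) = 0"
    unfolding eventually_nhds_metric
    by (rule exI[of _ \<rho>]) (use \<rho> fp g1 in \<open>auto simp: T_eq dist_commute\<close>)
  ultimately show ?thesis using a_an by blast
qed

lemma analytic_on_0_compose_power:
  assumes "f analytic_on {0}" "n > 0"
  shows "(\<lambda>z. f (z ^ n)) analytic_on {0::complex}"
proof -
  have "(f \<circ> (\<lambda>z. z ^ n)) analytic_on {0}"
    using assms by (intro analytic_on_compose analytic_intros) (auto simp: power_0_left)
  then show ?thesis by (simp add: o_def)
qed

text \<open>The lowest power of t is taken out of the expansion. All later arguments on orders of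
  vanishing, isolated zeros and quotients go through this form.\<close>

lemma analytic_factor_power:
  assumes k: "k analytic_on {0}" and nz: "\<not> (\<forall>\<^sub>F t in nhds 0. k t = (0::complex))"
  obtains m u where "u analytic_on {0}" "u 0 \<noteq> 0" "\<forall>\<^sub>F t in nhds 0. k t = t ^ m * u t"
proof -
  obtain F where F: "k has_fps_expansion F"
    using analytic_at_imp_has_fps_expansion_0[OF k] by blast
  have "F \<noteq> 0" using F nz has_fps_expansion_0_iff by blast
  define G where "G = fps_shift (subdegree F) F"
  have FG: "F = fps_X ^ subdegree F * G"
    using subdegree_decompose[of F] by (simp add: G_def mult.commute)
  have "fps_conv_radius G > 0"
    using F by (simp add: G_def has_fps_expansion_def)
  then have G: "eval_fps G has_fps_expansion G"
    by (rule eval_fps_has_fps_expansion)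
  then have "(\<lambda>t. t ^ subdegree F * eval_fps G t) has_fps_expansion F"
    by (subst FG) (intro fps_expansion_intros)
  then have "\<forall>\<^sub>F t in nhds 0. eval_fps F t = t ^ subdegree F * eval_fps G t"
    by (simp add: has_fps_expansion_def)
  moreover have "\<forall>\<^sub>F t in nhds 0. eval_fps F t = k t"
    using F by (simp add: has_fps_expansion_def)
  ultimately have "\<forall>\<^sub>F t in nhds 0. k t = t ^ subdegree F * eval_fps G t"
    by eventually_elim simp
  moreover have "eval_fps G analytic_on {0}"
    using G has_fps_expansion_imp_analytic_0 by blast
  moreover have "eval_fps G 0 \<noteq> 0"
    using \<open>F \<noteq> 0\<close> by (simp add: eval_fps_at_0 G_def)
  ultimately show ?thesis using that by blast
qed

section \<open>The Newton-Puiseux algorithm for polynomials in y with analytic coefficients\<close>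

text \<open>These are the coefficients in w after substituting c + w. The truncated difference
  \<open>i - j\<close> is harmless, since \<open>i choose j\<close> vanishes for i < j.\<close>

definition taylor_shift :: "nat \<Rightarrow> (nat \<Rightarrow> 'a) \<Rightarrow> 'a \<Rightarrow> nat \<Rightarrow> 'a::comm_ring_1" where
  "taylor_shift d h c j = (\<Sum>i\<le>d. of_nat (i choose j) * h i * c ^ (i - j))"

lemma sum_taylor_shift:
  "(\<Sum>i\<le>d. h i * (c + w) ^ i) = (\<Sum>j\<le>d. taylor_shift d h c j * w ^ j)"
proof -
  have "(c + w) ^ i = (\<Sum>j\<le>d. of_nat (i choose j) * c ^ (i - j) * w ^ j)" if "i \<le> d" for i
  proof -
    have "(c + w) ^ i = (\<Sum>j\<le>i. of_nat (i choose j) * c ^ (i - j) * w ^ j)"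
      by (subst add.commute) (simp add: binomial_ring mult.assoc mult.left_commute mult.commute[of "w ^ _"])
    also have "\<dots> = (\<Sum>j\<le>d. of_nat (i choose j) * c ^ (i - j) * w ^ j)"
      using that by (intro sum.mono_neutral_left) (auto simp: binomial_eq_0)
    finally show ?thesis .
  qed
  then have "(\<Sum>i\<le>d. h i * (c + w) ^ i) =
      (\<Sum>i\<le>d. \<Sum>j\<le>d. of_nat (i choose j) * h i * c ^ (i - j) * w ^ j)"
    by (intro sum.cong) (simp_all add: sum_distrib_left algebra_simps)
  then show ?thesis
    by (subst (asm) sum.swap) (simp add: taylor_shift_def sum_distrib_right)
qed

lemma taylor_shift_0: "j \<le> d \<Longrightarrow> taylor_shift d h 0 j = h j"
proof -
  assume "j \<le> d"
  have "taylor_shift d h 0 j = (\<Sum>i\<le>d. if i = j then h i else 0)"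
    unfolding taylor_shift_def
  proof (intro sum.cong refl)
    fix i
    show "of_nat (i choose j) * h i * 0 ^ (i - j) = (if i = j then h i else 0)"
      by (cases i j rule: linorder_cases) (auto simp: binomial_eq_0 power_0_left)
  qed
  then show ?thesis using \<open>j \<le> d\<close> by simp
qed

lemma taylor_shift_top:
  assumes "r \<le> d" "\<And>i. i \<le> d \<Longrightarrow> i > r \<Longrightarrow> h i = 0"
  shows "taylor_shift d h c r = h r"
proof -
  have "taylor_shift d h c r = (\<Sum>i\<le>d. if i = r then h i else 0)"
    unfolding taylor_shift_def
  proof (intro sum.cong refl)
    fix i assume "i \<in> {..d}"
    then show "of_nat (i choose r) * h i * c ^ (i - r) = (if i = r then h i else 0)"
      using assms(2)[of i] by (cases i r rule: linorder_cases) (auto simp: binomial_eq_0)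
  qed
  then show ?thesis using assms(1) by simp
qed

text \<open>Translation by c changes the second coefficient from the top by a multiple of c. So if
  that coefficient vanishes before and after and the top one is nonzero, then c = 0; this excludes
  an r-fold root away from 0.\<close>

lemma taylor_shift_subtop:
  assumes "Suc r \<le> d" "\<And>i. i \<le> d \<Longrightarrow> i > Suc r \<Longrightarrow> h i = 0"
  shows "taylor_shift d h c r = h r + of_nat (Suc r) * h (Suc r) * c"
proof -
  have "taylor_shift d h c r = (\<Sum>i\<le>d. (if i = r then h i else 0) +
      (if i = Suc r then of_nat (Suc r) * h i * c else 0))"
    unfolding taylor_shift_def
  proof (intro sum.cong refl)
    fix i assume i: "i \<in> {..d}"
    consider "i < r" | "i = r" | "i = Suc r" | "i > Suc r" by linarith
    then show "of_nat (i choose r) * h i * c ^ (i - r) = (if i = r then h i else 0) +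
      (if i = Suc r then of_nat (Suc r) * h i * c else 0)"
      using assms(2)[of i] i by cases (auto simp: binomial_eq_0)
  qed
  then show ?thesis using assms(1) by (simp add: sum.distrib)
qed

lemma taylor_shift_analytic:
  assumes "\<And>i. i \<le> d \<Longrightarrow> h i analytic_on S" "a analytic_on S"
  shows "(\<lambda>t. taylor_shift d (\<lambda>i. h i t) (a t) j) analytic_on S"
  unfolding taylor_shift_def using assms by (auto intro!: analytic_intros)

text \<open>Cauchy's root bound with a leading coefficient that only has to stay away from 0. Thus A
  may itself depend on z, and in the application it absorbs the terms of degree above r.\<close>

lemma root_norm_bound:
  fixes z :: "'a::real_normed_field"
  assumes eq: "A * z ^ r + (\<Sum>j<r. K j * z ^ j) = 0" and A: "\<delta> \<le> norm A" and \<delta>: "0 < \<delta>"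
    and K: "\<And>j. j < r \<Longrightarrow> norm (K j) \<le> M"
  shows "norm z \<le> max 1 (real r * M / \<delta>)"
proof (cases "norm z \<le> 1")
  case False
  then have z: "norm z > 1" by simp
  have "r > 0" using eq A \<delta> by (cases r) auto
  have "\<delta> * norm z ^ r \<le> norm (A * z ^ r)"
    using A by (simp add: norm_mult norm_power mult_right_mono)
  also have "A * z ^ r = - (\<Sum>j<r. K j * z ^ j)"
    using eq by (simp add: eq_neg_iff_add_eq_0)
  also have "norm \<dots> \<le> (\<Sum>j<r. M * norm z ^ (r - 1))"
    unfolding norm_minus_cancel
  proof (rule sum_norm_le)
    fix j assume j: "j \<in> {..<r}"
    then have "norm z ^ j \<le> norm z ^ (r - 1)" using z by (intro power_increasing) auto
    moreover have "0 \<le> M" using K[of j] j norm_ge_zero order_trans by blast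
    ultimately show "norm (K j * z ^ j) \<le> M * norm z ^ (r - 1)"
      using K[of j] j by (auto simp: norm_mult norm_power intro!: mult_mono)
  qed
  also have "\<dots> = (real r * M) * norm z ^ (r - 1)" by simp
  finally have "\<delta> * norm z * norm z ^ (r - 1) \<le> (real r * M) * norm z ^ (r - 1)"
    using \<open>r > 0\<close> by (cases r) (auto simp: algebra_simps)
  then have "\<delta> * norm z \<le> real r * M"
    by (rule mult_right_le_imp_le) (rule zero_less_power, use z in linarith)
  then have "norm z \<le> real r * M / \<delta>" using \<delta> by (simp add: pos_le_divide_eq mult.commute)
  then show ?thesis by (rule order_trans[OF _ max.cobounded2])
qed (rule order_trans[OF _ max.cobounded1])

lemma isCont_tendsto_nhds_compose:
  assumes "f analytic_on {0::complex}" "(g \<longlongrightarrow> 0) F"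
  shows "((\<lambda>x. f (g x)) \<longlongrightarrow> f 0) F"
  by (rule isCont_tendsto_compose[OF analytic_at_imp_isCont[OF assms(1)] assms(2)])

text \<open>The induction is on the multiplicity \<open>r\<close> of \<open>y = 0\<close> as a root at \<open>t = 0\<close>. Solving
  \<open>\<partial>\<^sup>r\<^sup>-\<^sup>1 H / \<partial> y\<^sup>r\<^sup>-\<^sup>1 = 0\<close> for \<open>y = a(t)\<close> and substituting \<open>y = a(t) + w\<close> kills the coefficient
  of \<open>w\<^sup>r\<^sup>-\<^sup>1\<close>. After rescaling along the edge of the Newton polygon that ends at \<open>w\<^sup>r\<close> the limit polynomial is then not
  an \<open>r\<close>-th power of a linear factor, so that each of its roots has multiplicity less than \<open>r\<close>.\<close>

lemma puiseux_branch_along_sequence: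
  fixes h :: "nat \<Rightarrow> complex \<Rightarrow> complex" and t :: "nat \<Rightarrow> real" and y :: "nat \<Rightarrow> complex"
  assumes "\<And>j. j \<le> d \<Longrightarrow> h j analytic_on {0}" "\<And>j. j < r \<Longrightarrow> h j 0 = 0" "h r 0 \<noteq> 0" "r \<le> d"
    and "filterlim t (at_right 0) sequentially" "y \<longlonglongrightarrow> 0"
    and "\<forall>\<^sub>F k in sequentially. (\<Sum>j\<le>d. h j (of_real (t k)) * y k ^ j) = 0"
  shows "\<exists>N>0. \<exists>\<psi>. \<psi> analytic_on {0} \<and>
    (\<exists>\<^sub>F k in sequentially. y k = \<psi> (of_real (root N (t k))))"
  using assms
proof (induction r arbitrary: h t y rule: less_induct)
  case (less r)
  note an = less.prems(1) and h0 = less.prems(2) and hr = less.prems(3) and rd = less.prems(4)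
    and t = less.prems(5) and y = less.prems(6) and eq = less.prems(7)
  have t0: "t \<longlonglongrightarrow> 0" and tpos: "\<forall>\<^sub>F k in sequentially. t k > 0"
    using t by (auto simp: filterlim_at elim: eventually_mono)
  have tc: "(\<lambda>k. complex_of_real (t k)) \<longlonglongrightarrow> 0"
    using tendsto_of_real[OF t0] by simp
  \<comment> \<open>For r = 0 there are no zeros near the origin: the left side of the equation
    tends to \<open>h 0 0\<close> along the sequence.\<close>
  have "r > 0"
  proof (rule ccontr)
    assume "\<not> r > 0"
    have "(\<lambda>k. \<Sum>j\<le>d. h j (of_real (t k)) * y k ^ j) \<longlonglongrightarrow> (\<Sum>j\<le>d. h j 0 * 0 ^ j)"
      by (intro tendsto_sum tendsto_mult tendsto_power isCont_tendsto_nhds_compose[OF an tc] y) auto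
    also have "(\<Sum>j\<le>d. h j 0 * 0 ^ j) = h 0 0"
      by (simp add: power_0_left if_distrib cong: if_cong)
    finally have "h 0 0 = 0"
      by (rule LIMSEQ_unique[OF _ tendsto_eventually[OF eq]])
    then show False using hr \<open>\<not> r > 0\<close> by simp
  qed
  then obtain r' where r': "r = Suc r'" by (cases r) auto
  \<comment> \<open>This is the derivative of order r - 1 in y divided by (r - 1)!. At t = 0 its
    constant term is \<open>h r' 0 = 0\<close> and its linear coefficient is r times
    \<open>h r 0\<close>, as the implicit function lemma requires.\<close>
  have "\<exists>a. a analytic_on {0} \<and> a 0 = 0 \<and>
    (\<forall>\<^sub>F t in nhds 0. (\<Sum>i\<le>d - r'. (of_nat ((i + r') choose r') * h (i + r') t) * a t ^ i) = 0)"
  proof (rule analytic_implicit_function)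
    show "(\<lambda>t. of_nat ((j + r') choose r') * h (j + r') t) analytic_on {0}" if "j \<le> d - r'" for j
      using an[of "j + r'"] that rd r' by (auto intro!: analytic_intros)
  qed (use h0[of r'] hr rd r' in \<open>auto simp del: of_nat_Suc\<close>)
  then obtain a where a: "a analytic_on {0}" "a 0 = 0" and
    "\<forall>\<^sub>F t in nhds 0. (\<Sum>i\<le>d - r'. (of_nat ((i + r') choose r') * h (i + r') t) * a t ^ i) = 0"
    by blast
  moreover have "(\<Sum>i\<le>d - r'. (of_nat ((i + r') choose r') * h (i + r') t) * a t ^ i) =
      taylor_shift d (\<lambda>i. h i t) (a t) r'" for t
  proof -
    have "taylor_shift d (\<lambda>i. h i t) (a t) r' =
        (\<Sum>i=0+r'..(d-r')+r'. of_nat (i choose r') * h i t * a t ^ (i - r'))"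
      unfolding taylor_shift_def using rd r'
      by (intro sum.mono_neutral_right) (auto simp: binomial_eq_0)
    then show ?thesis
      unfolding sum.shift_bounds_cl_nat_ivl by (simp add: atLeast0AtMost)
  qed
  ultimately have ev_r': "\<forall>\<^sub>F t in nhds 0. taylor_shift d (\<lambda>i. h i t) (a t) r' = 0"
    by simp
  define k where "k j t = taylor_shift d (\<lambda>i. h i t) (a t) j" for j t
  have k_an: "k j analytic_on {0}" for j
    unfolding k_def using an a by (intro taylor_shift_analytic)
  have k0: "k j 0 = h j 0" if "j \<le> d" for j
    using that a by (simp add: k_def taylor_shift_0)
  define w where "w n = y n - a (of_real (t n))" for n
  have w: "w \<longlonglongrightarrow> 0"
    using tendsto_diff[OF y isCont_tendsto_nhds_compose[OF a(1) tc]] a(2) by (simp add: w_def[abs_def])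
  have eqw: "\<forall>\<^sub>F n in sequentially. (\<Sum>j\<le>d. k j (of_real (t n)) * w n ^ j) = 0"
    using eq
  proof eventually_elim
    case (elim n)
    then show ?case
      using sum_taylor_shift[of "\<lambda>i. h i (of_real (t n))" "a (of_real (t n))" "w n" d]
      by (simp add: k_def w_def)
  qed
  \<comment> \<open>The terms of degree at least r are collected in \<open>A n * w n ^ r\<close>. As
    A tends to \<open>h r 0\<close>, this acts as a Weierstrass polynomial of degree r, though only
    along the sequence.\<close>
  define A where "A n = (\<Sum>j=r..d. k j (of_real (t n)) * w n ^ (j - r))" for n
  have "A \<longlonglongrightarrow> (\<Sum>j=r..d. k j 0 * 0 ^ (j - r))"
    unfolding A_def by (intro tendsto_sum tendsto_mult tendsto_power isCont_tendsto_nhds_compose[OF k_an tc] w)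
  also have "(\<Sum>j=r..d. k j 0 * 0 ^ (j - r)) = (\<Sum>j=r..d. if j = r then k j 0 else 0)"
    by (intro sum.cong) (auto simp: power_0_left)
  also have "\<dots> = h r 0" using rd by (simp add: k0)
  finally have A: "A \<longlonglongrightarrow> h r 0" .
  have eqA: "\<forall>\<^sub>F n in sequentially. A n * w n ^ r + (\<Sum>j<r. k j (of_real (t n)) * w n ^ j) = 0"
    using eqw
  proof eventually_elim
    case (elim n)
    have "{..d} = {..<r} \<union> {r..d}" using rd by auto
    then have "(\<Sum>j\<le>d. k j (of_real (t n)) * w n ^ j) =
       (\<Sum>j<r. k j (of_real (t n)) * w n ^ j) + (\<Sum>j=r..d. k j (of_real (t n)) * w n ^ j)"
      by (simp add: sum.union_disjoint ivl_disj_int)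
    also have "(\<Sum>j=r..d. k j (of_real (t n)) * w n ^ j) = A n * w n ^ r"
      unfolding A_def sum_distrib_right
      by (intro sum.cong) (auto simp: mult.assoc simp flip: power_add)
    finally show ?case using elim by (simp add: add.commute)
  qed
  \<comment> \<open>Each j in J gives a point (j, m j) of the Newton polygon to the left of (r, 0).
    If there is none, the equation reduces to \<open>A n * w n ^ r = 0\<close> and the branch is a
    itself.\<close>
  define J where "J = {j. j < r \<and> \<not> (\<forall>\<^sub>F t in nhds 0. k j t = 0)}"
  show ?case
  proof (cases "J = {}")
    case True
    have "\<forall>\<^sub>F n in sequentially. \<forall>j\<in>{..<r}. k j (of_real (t n)) = 0"
      using True by (intro eventually_ball_finite ballI eventually_compose_filterlim[OF _ tc]) (auto simp: J_def)
    moreover have "\<forall>\<^sub>F n in sequentially. A n \<noteq> 0"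
      using A hr by (rule tendsto_imp_eventually_ne)
    ultimately have "\<forall>\<^sub>F n in sequentially. y n = a (of_real (root 1 (t n)))"
      using eqA by eventually_elim (auto simp: w_def)
    then show ?thesis
      using a(1) by (intro exI[of _ 1] conjI exI[of _ a] eventually_frequently) auto
  next
    case False
    have "\<forall>j\<in>J. \<exists>m u. u analytic_on {0} \<and> u 0 \<noteq> 0 \<and> (\<forall>\<^sub>F t in nhds 0. k j t = t ^ m * u t)"
      using analytic_factor_power[OF k_an] unfolding J_def by blast
    then obtain m u where u_an: "\<And>j. j \<in> J \<Longrightarrow> u j analytic_on {0}" and u0: "\<And>j. j \<in> J \<Longrightarrow> u j 0 \<noteq> 0"
      and ku: "\<And>j. j \<in> J \<Longrightarrow> \<forall>\<^sub>F t in nhds 0. k j t = t ^ m j * u j t"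
      by metis
    have mpos: "m j > 0" if "j \<in> J" for j
    proof (rule ccontr)
      assume "\<not> m j > 0"
      then have "k j 0 = u j 0" using eventually_nhds_x_imp_x[OF ku[OF that]] by simp
      then show False using u0[OF that] k0[of j] h0[of j] that rd by (auto simp: J_def)
    qed
    \<comment> \<open>\<open>q j\<close> is the rate at which the segment from (j, m j) descends to
      (r, 0); the smallest rate p / b belongs to the edge. Substituting t = s^b and w = s^p z gives
      term j the exponent \<open>b * m j + p * j\<close> in s, which is at least
      \<open>p * r\<close> by minimality. Common factors of p and b do no harm here.\<close>
    define q where "q j = real (m j) / real (r - j)" for j
    define j0 where "j0 = arg_min_on q J"
    have finJ: "finite J" by (simp add: J_def)
    have j0: "j0 \<in> J" and j0_min: "q j0 \<le> q j" if "j \<in> J" for j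
      using arg_min_if_finite[OF finJ False, of q] that by (auto simp: j0_def not_less)
    have "j0 \<in> J" using False j0 by blast
    define p b where "p = m j0" and "b = r - j0"
    have "j0 < r" using \<open>j0 \<in> J\<close> by (auto simp: J_def)
    then have "b > 0" "b + j0 = r" by (auto simp: b_def)
    have "p > 0" using mpos \<open>j0 \<in> J\<close> by (simp add: p_def)
    have slope: "p * r \<le> b * m j + p * j" if "j \<in> J" for j
    proof -
      have "j < r" using that by (simp add: J_def)
      have "real p * real (r - j) \<le> real b * real (m j)"
        using j0_min[OF that] \<open>j < r\<close> \<open>b > 0\<close> unfolding q_def p_def[symmetric] b_def[symmetric]
        by (simp add: field_simps)
      then have "p * (r - j) \<le> b * m j"
        by (metis of_nat_le_iff of_nat_mult)
      then show ?thesis using \<open>j < r\<close> by (simp add: diff_mult_distrib2)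
    qed
    \<comment> \<open>\<open>K j\<close> is the coefficient of z^j after division by s^(p r). At s =
      0 only the edge contributes: \<open>K j0 0\<close> and \<open>K r 0\<close> are nonzero,
      \<open>K j 0\<close> vanishes for j > r, and \<open>K r' 0 = 0\<close> by the choice of
      a.\<close>
    define K where "K j s = (if j < r then (if j \<in> J then s ^ (b * m j + p * j - p * r) * u j (s ^ b) else 0)
        else k j (s ^ b) * s ^ (p * (j - r)))" for j s
    have K_an: "K j analytic_on {0}" for j
    proof -
      have "(\<lambda>s. k j (s ^ b)) analytic_on {0}"
        using k_an \<open>b > 0\<close> by (rule analytic_on_0_compose_power)
      moreover have "(\<lambda>s. u j (s ^ b)) analytic_on {0}" if "j \<in> J"
        using u_an[OF that] \<open>b > 0\<close> by (rule analytic_on_0_compose_power)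
      ultimately show ?thesis
        unfolding K_def by (cases "j < r"; cases "j \<in> J") (auto intro!: analytic_intros)
    qed
    have K_eq: "\<forall>\<^sub>F s in nhds 0. k j (s ^ b) * s ^ (p * j) = K j s * s ^ (p * r)" for j
    proof -
      have pw: "filterlim (\<lambda>s::complex. s ^ b) (nhds 0) (nhds 0)"
        using tendsto_power[OF filterlim_ident[of "nhds (0::complex)"], of b] \<open>b > 0\<close>
        by (simp add: power_0_left)
      consider "j \<in> J" | "j < r" "j \<notin> J" | "j \<ge> r" by linarith
      then show ?thesis
      proof cases
        case 1
        then have "j < r" by (simp add: J_def)
        show ?thesis
          using eventually_compose_filterlim[OF ku[OF 1] pw]
        proof eventually_elim
          case (elim s)
          have "k j (s ^ b) * s ^ (p * j) = u j (s ^ b) * s ^ (b * m j + p * j)"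
            using elim by (simp add: power_add power_mult)
          also have "b * m j + p * j = (b * m j + p * j - p * r) + p * r"
            using slope[OF 1] by simp
          finally show ?case
            using 1 \<open>j < r\<close> by (simp add: K_def power_add)
        qed
      next
        case 2
        then have "\<forall>\<^sub>F t in nhds 0. k j t = 0" by (simp add: J_def)
        from eventually_compose_filterlim[OF this pw] show ?thesis
          by (rule eventually_mono) (use 2 in \<open>simp add: K_def\<close>)
      next
        case 3
        then have "p * j = p * (j - r) + p * r" by (simp add: diff_mult_distrib2)
        then show ?thesis using 3 by (simp add: K_def power_add)
      qed
    qed
    have Kr: "K r 0 = h r 0" using k0[OF rd] \<open>b > 0\<close> by (simp add: K_def power_0_left)
    have Kgr: "K j 0 = 0" if "j > r" for j
      using that \<open>p > 0\<close> by (simp add: K_def power_0_left)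
    have Kr': "K r' 0 = 0"
      using ev_r' r' by (auto simp: K_def J_def k_def)
    have Kj0: "K j0 0 \<noteq> 0"
    proof -
      have "b * p + p * j0 - p * r = 0"
        using \<open>b + j0 = r\<close> by (simp add: algebra_simps flip: \<open>b + j0 = r\<close>)
      then show ?thesis using \<open>j0 \<in> J\<close> u0[of j0] \<open>j0 < r\<close> \<open>b > 0\<close> by (simp add: K_def p_def power_0_left)
    qed
    define s where "s n = root b (t n)" for n
    have s: "filterlim s (at_right 0) sequentially"
      unfolding filterlim_at s_def
      using tendsto_real_root[OF t0, of b] tpos \<open>b > 0\<close> by (auto elim!: eventually_mono)
    then have s0: "s \<longlonglongrightarrow> 0" and spos: "\<forall>\<^sub>F n in sequentially. s n > 0"
      by (auto simp: filterlim_at elim: eventually_mono)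
    have sc: "(\<lambda>n. complex_of_real (s n)) \<longlonglongrightarrow> 0"
      using tendsto_of_real[OF s0] by simp
    have sb: "\<forall>\<^sub>F n in sequentially. s n ^ b = t n"
      using tpos by eventually_elim (use \<open>b > 0\<close> in \<open>simp add: s_def\<close>)
    define z where "z n = w n / of_real (s n) ^ p" for n
    have wz: "\<forall>\<^sub>F n in sequentially. w n = of_real (s n) ^ p * z n"
      using spos by eventually_elim (simp add: z_def)
    have Ks: "\<forall>\<^sub>F n in sequentially. \<forall>j\<in>{..d}. k j (of_real (s n) ^ b) * of_real (s n) ^ (p * j) =
        K j (of_real (s n)) * of_real (s n) ^ (p * r)"
      by (intro eventually_ball_finite ballI eventually_compose_filterlim[OF K_eq sc]) auto
    have eqz: "\<forall>\<^sub>F n in sequentially. (\<Sum>j\<le>d. K j (of_real (s n)) * z n ^ j) = 0"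
      using eqw Ks wz sb spos
    proof eventually_elim
      case (elim n)
      have tn: "complex_of_real (t n) = of_real (s n) ^ b"
        using elim(4) by (metis of_real_power)
      have "0 = (\<Sum>j\<le>d. k j (of_real (s n) ^ b) * of_real (s n) ^ (p * j) * z n ^ j)"
        using elim(1,3) by (simp add: tn power_mult_distrib power_mult mult.assoc)
      also have "\<dots> = (\<Sum>j\<le>d. K j (of_real (s n)) * of_real (s n) ^ (p * r) * z n ^ j)"
        using elim(2) by simp
      also have "\<dots> = of_real (s n) ^ (p * r) * (\<Sum>j\<le>d. K j (of_real (s n)) * z n ^ j)"
        by (simp add: sum_distrib_left algebra_simps)
      finally show ?case using elim(5) by simp
    qed
    have eqAz: "\<forall>\<^sub>F n in sequentially. A n * z n ^ r + (\<Sum>j<r. K j (of_real (s n)) * z n ^ j) = 0"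
      using eqA Ks wz sb spos
    proof eventually_elim
      case (elim n)
      have tn: "complex_of_real (t n) = of_real (s n) ^ b"
        using elim(4) by (metis of_real_power)
      have "0 = A n * of_real (s n) ^ (p * r) * z n ^ r +
          (\<Sum>j<r. k j (of_real (s n) ^ b) * of_real (s n) ^ (p * j) * z n ^ j)"
        using elim(1,3) by (simp add: tn power_mult_distrib power_mult mult.assoc)
      also have "(\<Sum>j<r. k j (of_real (s n) ^ b) * of_real (s n) ^ (p * j) * z n ^ j) =
          (\<Sum>j<r. K j (of_real (s n)) * of_real (s n) ^ (p * r) * z n ^ j)"
        using elim(2) rd by (intro sum.cong) auto
      also have "A n * of_real (s n) ^ (p * r) * z n ^ r + \<dots> =
          of_real (s n) ^ (p * r) * (A n * z n ^ r + (\<Sum>j<r. K j (of_real (s n)) * z n ^ j))"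
        by (simp add: sum_distrib_left algebra_simps)
      finally show ?case using elim(5) by simp
    qed
    \<comment> \<open>The form of the equation with A is the right one here: terms of degree above r
      are controlled through w, which tends to 0, while z is not yet known to be bounded.\<close>
    obtain B where B: "\<forall>\<^sub>F n in sequentially. norm (z n) \<le> B"
    proof -
      have "\<forall>\<^sub>F n in sequentially. norm (A n) > norm (h r 0) / 2"
        using tendsto_norm[OF A] hr by (intro order_tendstoD(1)) auto
      moreover define M where "M = (\<Sum>j<r. norm (K j 0)) + 1"
      have "\<forall>\<^sub>F n in sequentially. \<forall>j\<in>{..<r}. norm (K j (of_real (s n))) < M"
      proof (intro eventually_ball_finite ballI)
        fix j assume "j \<in> {..<r}"
        then have "norm (K j 0) < M"
          using member_le_sum[of j "{..<r}" "\<lambda>j. norm (K j 0)"] by (simp add: M_def)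
        then show "\<forall>\<^sub>F n in sequentially. norm (K j (of_real (s n))) < M"
          using tendsto_norm[OF isCont_tendsto_nhds_compose[OF K_an sc]] order_tendstoD(2) by blast
      qed simp
      ultimately have "\<forall>\<^sub>F n in sequentially. norm (z n) \<le> max 1 (real r * M / (norm (h r 0) / 2))"
        using eqAz
      proof eventually_elim
        case (elim n)
        show ?case
          by (rule root_norm_bound[OF elim(3)]) (use elim hr in \<open>auto simp: less_imp_le\<close>)
      qed
      then show ?thesis using that by blast
    qed
    then obtain n0 where n0: "\<And>n. n \<ge> n0 \<Longrightarrow> z n \<in> cball 0 B"
      by (auto simp: eventually_sequentially)
    obtain c \<sigma>' where \<sigma>': "strict_mono \<sigma>'" "((\<lambda>n. z (n + n0)) \<circ> \<sigma>') \<longlonglongrightarrow> c"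
      using compact_cball[of "0::complex" B, unfolded compact_def] n0
      by (metis (no_types, lifting) le_add2)
    define \<sigma> where "\<sigma> n = \<sigma>' n + n0" for n
    have \<sigma>: "strict_mono \<sigma>" using \<sigma>'(1) by (simp add: \<sigma>_def strict_mono_def)
    have z\<sigma>: "(\<lambda>n. z (\<sigma> n)) \<longlonglongrightarrow> c" using \<sigma>'(2) by (simp add: \<sigma>_def o_def)
    have fl\<sigma>: "filterlim \<sigma> sequentially sequentially" using \<sigma> by (rule filterlim_subseq)
    \<comment> \<open>Recentring at the limit c of the subsequence. The multiplicity of c as a root
      of the limit polynomial is \<rho>, and the induction applies once it is below r.\<close>
    define L where "L j s = taylor_shift d (\<lambda>i. K i s) c j" for j s
    have L_an: "L j analytic_on {0}" for j
      unfolding L_def by (intro taylor_shift_analytic K_an analytic_intros)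
    have Lr: "L r 0 \<noteq> 0"
      using taylor_shift_top[of r d "\<lambda>i. K i 0" c] rd Kgr Kr hr by (simp add: L_def)
    define \<rho> where "\<rho> = (LEAST j. L j 0 \<noteq> 0)"
    have L\<rho>: "L \<rho> 0 \<noteq> 0" unfolding \<rho>_def using Lr by (rule LeastI)
    have Lless: "L j 0 = 0" if "j < \<rho>" for j
      using not_less_Least[OF that[unfolded \<rho>_def]] by simp
    have "\<rho> \<le> r" unfolding \<rho>_def using Lr by (rule Least_le)
    \<comment> \<open>If \<rho> = r, the missing coefficient at r - 1 places the r-fold root at c =
      0, and then \<open>K j0 0\<close> would have to vanish.\<close>
    moreover have "\<rho> \<noteq> r"
    proof
      assume "\<rho> = r"
      then have "L r' 0 = 0" using Lless r' by simp
      then have "c = 0"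
        using taylor_shift_subtop[of r' d "\<lambda>i. K i 0" c] rd r' Kgr Kr' Kr hr
        by (simp add: L_def del: of_nat_Suc)
      then have "L j0 0 = K j0 0" using \<open>j0 < r\<close> rd by (simp add: L_def taylor_shift_0)
      then show False using Kj0 Lless[of j0] \<open>\<rho> = r\<close> \<open>j0 < r\<close> by simp
    qed
    ultimately have "\<rho> < r" by simp
    have "\<exists>N>0. \<exists>\<xi>. \<xi> analytic_on {0} \<and>
      (\<exists>\<^sub>F n in sequentially. z (\<sigma> n) - c = \<xi> (of_real (root N (s (\<sigma> n)))))"
    proof (rule less.IH[where h = L and ya = "\<lambda>n. z (\<sigma> n) - c" and t = "\<lambda>n. s (\<sigma> n)", OF \<open>\<rho> < r\<close>])
      show "L j analytic_on {0}" for j by (rule L_an)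
      show "L j 0 = 0" if "j < \<rho>" for j using that by (rule Lless)
      show "L \<rho> 0 \<noteq> 0" by (rule L\<rho>)
      show "\<rho> \<le> d" using \<open>\<rho> < r\<close> rd by simp
      show "filterlim (\<lambda>n. s (\<sigma> n)) (at_right 0) sequentially"
        using filterlim_compose[OF s fl\<sigma>] .
      show "(\<lambda>n. z (\<sigma> n) - c) \<longlonglongrightarrow> 0"
        using z\<sigma> LIM_zero by blast
      show "\<forall>\<^sub>F n in sequentially. (\<Sum>j\<le>d. L j (of_real (s (\<sigma> n))) * (z (\<sigma> n) - c) ^ j) = 0"
        using eventually_compose_filterlim[OF eqz fl\<sigma>]
      proof eventually_elim
        case (elim n)
        then show ?case
          using sum_taylor_shift[of "\<lambda>i. K i (of_real (s (\<sigma> n)))" c "z (\<sigma> n) - c" d]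
          by (simp add: L_def)
      qed
    qed
    then obtain N \<xi> where N: "N > 0" and \<xi>: "\<xi> analytic_on {0}" and
      fr: "\<exists>\<^sub>F n in sequentially. z (\<sigma> n) - c = \<xi> (of_real (root N (s (\<sigma> n))))"
      by blast
    \<comment> \<open>Undoing the substitutions: y = a(t) + s^p z with z = c + \<xi>(\<tau>), s =
      \<tau>^N and t = s^b.\<close>
    define \<psi> where "\<psi> \<tau> = a (\<tau> ^ (b * N)) + \<tau> ^ (p * N) * (c + \<xi> \<tau>)" for \<tau>
    have "(\<lambda>\<tau>. a (\<tau> ^ (b * N))) analytic_on {0}"
      using a N \<open>b > 0\<close> by (intro analytic_on_0_compose_power) auto
    then have "\<psi> analytic_on {0}"
      unfolding \<psi>_def using \<xi> by (auto intro!: analytic_intros)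
    moreover have "\<forall>\<^sub>F n in sequentially. z n - c = \<xi> (of_real (root N (s n))) \<longrightarrow>
        y n = \<psi> (of_real (root (b * N) (t n)))"
      using wz sb spos tpos
    proof eventually_elim
      case (elim n)
      show ?case
      proof
        assume z: "z n - c = \<xi> (of_real (root N (s n)))"
        define \<tau> where "\<tau> = root N (s n)"
        have \<tau>: "root (b * N) (t n) = \<tau>"
          by (simp add: \<tau>_def s_def real_root_mult_exp mult.commute)
        have "\<tau> ^ N = s n" using N elim(3) by (simp add: \<tau>_def)
        then have 1: "complex_of_real \<tau> ^ N = of_real (s n)" by (metis of_real_power)
        then have "complex_of_real \<tau> ^ (b * N) = of_real (t n)"
          using elim(2) by (metis mult.commute of_real_power power_mult)
        moreover have "complex_of_real \<tau> ^ (p * N) = of_real (s n) ^ p"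
          using 1 by (metis mult.commute power_mult)
        moreover have "z n = c + \<xi> (of_real \<tau>)" using z by (simp add: \<tau>_def algebra_simps)
        ultimately show "y n = \<psi> (of_real (root (b * N) (t n)))"
          using elim(1) unfolding \<tau> \<psi>_def w_def by (simp add: algebra_simps)
      qed
    qed
    then have "\<exists>\<^sub>F n in sequentially. y n = \<psi> (of_real (root (b * N) (t n)))"
    proof -
      assume *: "\<forall>\<^sub>F n in sequentially. z n - c = \<xi> (of_real (root N (s n))) \<longrightarrow>
        y n = \<psi> (of_real (root (b * N) (t n)))"
      have "\<exists>\<^sub>F n in sequentially. y (\<sigma> n) = \<psi> (of_real (root (b * N) (t (\<sigma> n))))"
        using frequently_rev_mp[OF fr eventually_compose_filterlim[OF * fl\<sigma>]] .
      then show ?thesis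
        unfolding frequently_def using eventually_compose_filterlim[OF _ fl\<sigma>] by blast
    qed
    ultimately show ?thesis using N \<open>b > 0\<close> by (intro exI[of _ "b * N"]) auto
  qed
qed

section \<open>Evaluation of real polynomials at complex numbers and at formal series\<close>

lemma bipoly_altdef: "bipoly h x y = (\<Sum>j\<le>degree h. poly (coeff h j) x * y ^ j)"
  by (simp add: bipoly_def poly_altdef[of h] poly_sum)

text \<open>The zero condition preserves all degrees, so passing to complex numbers and passing to
  constant series lead to the same explicit double sum.\<close>

lemma bipoly_map_poly:
  assumes "\<And>x. \<phi> x = 0 \<longleftrightarrow> x = 0"
  shows "bipoly (map_poly (map_poly \<phi>) h) x y =
    (\<Sum>j\<le>degree h. (\<Sum>i\<le>degree (coeff h j). \<phi> (coeff (coeff h j) i) * x ^ i) * y ^ j)"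
proof -
  have 1: "degree (map_poly (map_poly \<phi>) h) = degree h"
    using assms by (intro degree_map_poly) (simp add: map_poly_eq_0_iff)
  have 2: "degree (map_poly \<phi> p) = degree p" for p
    using assms by (intro degree_map_poly) simp
  show ?thesis
    using assms by (simp add: bipoly_altdef 1 poly_altdef 2 coeff_map_poly)
qed

abbreviation complex_bipoly :: "real poly poly \<Rightarrow> complex poly poly" where
  "complex_bipoly h \<equiv> map_poly (map_poly complex_of_real) h"

lemma bipoly_complex:
  "bipoly (complex_bipoly h) x y =
    (\<Sum>j\<le>degree h. (\<Sum>i\<le>degree (coeff h j). of_real (coeff (coeff h j) i) * x ^ i) * y ^ j)"
  by (rule bipoly_map_poly) simp

lemma bipoly_complex_of_real:
  "bipoly (complex_bipoly h) (of_real x) (of_real y) = of_real (bipoly h x y)"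
  unfolding bipoly_complex by (simp add: bipoly_altdef poly_altdef)

lemma bipoly_fps:
  "bipoly (map_poly (map_poly fps_const) (complex_bipoly h)) P \<Psi> =
    (\<Sum>j\<le>degree h. (\<Sum>i\<le>degree (coeff h j). fps_const (of_real (coeff (coeff h j) i)) * P ^ i) * \<Psi> ^ j)"
proof -
  have "map_poly (map_poly fps_const) (complex_bipoly h) =
      map_poly (map_poly (\<lambda>c. fps_const (complex_of_real c))) h"
    by (simp add: map_poly_map_poly o_def)
  then show ?thesis by (simp add: bipoly_map_poly)
qed

text \<open>The bridge between the formal identity in \<open>puiseux_roots\<close> and the vanishing
  of an analytic function near 0.\<close>

lemma has_fps_expansion_bipoly:
  assumes "p has_fps_expansion P" "\<psi> has_fps_expansion \<Psi>"
  shows "(\<lambda>t. bipoly (complex_bipoly h) (p t) (\<psi> t)) has_fps_expansion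
    bipoly (map_poly (map_poly fps_const) (complex_bipoly h)) P \<Psi>"
  unfolding bipoly_fps bipoly_complex
  by (intro has_fps_expansion_sum has_fps_expansion_mult has_fps_expansion_const
      has_fps_expansion_power assms)

text \<open>Identity theorem in filter form: an f not identically zero near 0 is a power of t times
  a function that is nonzero at 0, hence has no other zeros near 0.\<close>

lemma analytic_frequently_zero:
  assumes "f analytic_on {0::complex}" "filterlim s (at 0) F" "\<exists>\<^sub>F k in F. f (s k) = 0"
  shows "\<forall>\<^sub>F z in nhds 0. f z = 0"
proof (rule ccontr)
  assume "\<not> ?thesis"
  then obtain m u where u: "u analytic_on {0}" "u 0 \<noteq> 0" and eq: "\<forall>\<^sub>F t in nhds 0. f t = t ^ m * u t"
    using analytic_factor_power[OF assms(1)] by blast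
  have s0: "filterlim s (nhds 0) F" using assms(2) by (simp add: filterlim_at)
  have "\<forall>\<^sub>F k in F. u (s k) \<noteq> 0"
    using isCont_tendsto_nhds_compose[OF u(1) s0] u(2) by (rule tendsto_imp_eventually_ne)
  moreover have "\<forall>\<^sub>F k in F. s k \<noteq> 0" using assms(2) by (simp add: filterlim_at)
  ultimately have "\<forall>\<^sub>F k in F. f (s k) \<noteq> 0"
    using eventually_compose_filterlim[OF eq s0] by eventually_elim simp
  then show False using assms(3) by (simp add: frequently_def)
qed

lemma Im_eval_fps_of_real:
  assumes "norm s < fps_conv_radius \<Psi>"
  shows "(\<lambda>k. Im (fps_nth \<Psi> k) * s ^ k) sums Im (eval_fps \<Psi> (of_real s))"
proof -
  have "(\<lambda>k. fps_nth \<Psi> k * of_real s ^ k) sums eval_fps \<Psi> (of_real s)"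
    unfolding eval_fps_def by (intro summable_sums summable_fps) (use assms in simp)
  from sums_Im[OF this] show ?thesis by (simp flip: of_real_power)
qed

lemma eventually_norm_less_conv_radius:
  assumes "fps_conv_radius \<Psi> > 0"
  shows "\<forall>\<^sub>F s in nhds (0::real). norm s < fps_conv_radius (\<Psi> :: complex fps)"
proof -
  obtain R where R: "0 < ereal R" "ereal R < fps_conv_radius \<Psi>"
    using assms ereal_dense2 by blast
  then have "\<forall>\<^sub>F s in nhds (0::real). s \<in> ball 0 R"
    by (intro eventually_nhds_in_open) auto
  then show ?thesis
    by (rule eventually_mono) (use R(2) in \<open>auto intro: less_trans[of _ "ereal R"]\<close>)
qed

lemma eval_real_fps_in_Reals:
  assumes "\<And>k. fps_nth \<Psi> k \<in> \<real>" "norm s < fps_conv_radius \<Psi>"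
  shows "eval_fps \<Psi> (of_real s) = of_real (Re (eval_fps \<Psi> (complex_of_real s)))"
proof -
  have "Im (eval_fps \<Psi> (of_real s)) = 0"
    using Im_eval_fps_of_real[OF assms(2)] assms(1)
    by (auto simp: complex_is_Real_iff intro: sums_unique2)
  then show ?thesis by (simp add: complex_eq_iff)
qed

text \<open>On the real axis the series of imaginary parts evaluates to the imaginary part of
  \<Psi>. It vanishes at real points accumulating at 0, so it is the zero series.\<close>

lemma fps_real_if_frequently_real:
  fixes \<Psi> :: "complex fps" and s :: "'a \<Rightarrow> real"
  assumes rad: "fps_conv_radius \<Psi> > 0" and s: "filterlim s (at 0) F"
    and fr: "\<exists>\<^sub>F k in F. eval_fps \<Psi> (of_real (s k)) \<in> \<real>"
  shows "fps_nth \<Psi> k \<in> \<real>"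
proof -
  define \<Omega> where "\<Omega> = Abs_fps (\<lambda>k. complex_of_real (Im (fps_nth \<Psi> k)))"
  have \<Omega>_sums: "(\<lambda>k. fps_nth \<Omega> k * of_real s ^ k) sums of_real (Im (eval_fps \<Psi> (of_real s)))"
    if "norm s < fps_conv_radius \<Psi>" for s :: real
    using sums_of_real[OF Im_eval_fps_of_real[OF that], where 'a = complex] by (simp add: \<Omega>_def)
  obtain R where R: "0 < ereal R" "ereal R < fps_conv_radius \<Psi>"
    using rad ereal_dense2 by blast
  \<comment> \<open>Summability at the single real point R > 0 already gives a positive radius of
    convergence.\<close>
  have "ereal (norm (complex_of_real R)) \<le> fps_conv_radius \<Omega>"
    unfolding fps_conv_radius_def
    by (rule conv_radius_geI) (use \<Omega>_sums[of R] R in \<open>auto simp: sums_iff\<close>)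
  then have "fps_conv_radius \<Omega> > 0" using R(1) by (intro less_le_trans[OF R(1)]) simp
  then have \<Omega>: "eval_fps \<Omega> has_fps_expansion \<Omega>" by (rule eval_fps_has_fps_expansion)
  have s0: "filterlim s (nhds 0) F" and "\<forall>\<^sub>F k in F. s k \<noteq> 0"
    using s by (auto simp: filterlim_at)
  then have sc: "filterlim (\<lambda>k. complex_of_real (s k)) (at 0) F"
    using tendsto_of_real[OF s0, where 'a = complex] by (simp add: filterlim_at)
  have "\<exists>\<^sub>F k in F. eval_fps \<Omega> (of_real (s k)) = 0"
    using fr eventually_compose_filterlim[OF eventually_norm_less_conv_radius[OF rad] s0]
  proof (rule frequently_rev_mp[OF _ eventually_mono])
    fix k assume "norm (s k) < fps_conv_radius \<Psi>"
    then have "eval_fps \<Omega> (of_real (s k)) = of_real (Im (eval_fps \<Psi> (of_real (s k))))"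
      unfolding eval_fps_def[of \<Omega>] using \<Omega>_sums by (simp add: sums_iff)
    then show "eval_fps \<Psi> (of_real (s k)) \<in> \<real> \<longrightarrow> eval_fps \<Omega> (of_real (s k)) = 0"
      by (simp add: complex_is_Real_iff)
  qed
  then have "\<forall>\<^sub>F z in nhds 0. eval_fps \<Omega> z = 0"
    using analytic_frequently_zero[OF has_fps_expansion_imp_analytic_0[OF \<Omega>] sc] by blast
  then have "\<Omega> = 0"
    using \<Omega> has_fps_expansion_0_iff fps_expansion_unique_complex by blast
  then have "fps_nth \<Omega> k = 0" by simp
  then show ?thesis by (simp add: \<Omega>_def complex_is_Real_iff)
qed

section \<open>Real Puiseux roots and the branches they parametrise\<close>

lemma P_plus_props:
  assumes "(n, \<Psi>) \<in> P_plus h"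
  shows "n > 0" "fps_conv_radius \<Psi> > 0" "fps_nth \<Psi> 0 = 0" "\<And>k. fps_nth \<Psi> k \<in> \<real>"
    "bipoly (map_poly (map_poly fps_const) (complex_bipoly h)) (fps_X ^ n) \<Psi> = 0"
  using assms by (auto simp: P_plus_def puiseux_roots_def puiseux_series_def real_puiseux_def)

lemma filterlim_root_at_right:
  assumes "n > 0"
  shows "filterlim (root n) (at_right 0) (at_right 0)"
  unfolding filterlim_at
proof
  show "\<forall>\<^sub>F x in at_right 0. root n x \<in> {0<..} \<and> root n x \<noteq> 0"
    using eventually_at_right_less[of "0::real"] assms by (auto elim!: eventually_mono)
  show "(root n \<longlongrightarrow> 0) (at_right 0)"
    using tendsto_real_root[OF tendsto_ident_at, of n 0 "{0<..}"] by simp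
qed

text \<open>Real coefficients make the value at a real argument real, so the \<open>Re\<close> in
  \<open>puiseux_eval\<close> loses nothing near 0.\<close>

lemma puiseux_eval_complex:
  assumes "\<gamma> \<in> P_plus h"
  shows "\<forall>\<^sub>F x in at_right 0. complex_of_real (puiseux_eval \<gamma> x) =
    eval_fps (snd \<gamma>) (of_real (root (fst \<gamma>) x))"
proof -
  obtain n \<Psi> where \<gamma>: "\<gamma> = (n, \<Psi>)" by fastforce
  note P = P_plus_props[OF assms[unfolded \<gamma>]]
  have "filterlim (root n) (nhds 0) (at_right 0)"
    using filterlim_root_at_right[OF P(1)] by (simp add: filterlim_at)
  from eventually_compose_filterlim[OF eventually_norm_less_conv_radius[OF P(2)] this]
  show ?thesis
    using eval_real_fps_in_Reals[OF P(4)] by (auto simp: puiseux_eval_def \<gamma> elim!: eventually_mono)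
qed

lemma tendsto_eval_fps_root:
  assumes "n > 0" "fps_conv_radius \<Psi> > 0"
  shows "((\<lambda>x. eval_fps \<Psi> (complex_of_real (root n x))) \<longlongrightarrow> fps_nth \<Psi> 0) (at_right 0)"
proof -
  have "((\<lambda>x. complex_of_real (root n x)) \<longlongrightarrow> 0) (at_right 0)"
    using filterlim_root_at_right[OF assms(1)] tendsto_of_real[of "root n" 0 "at_right 0"]
    by (simp add: filterlim_at)
  from isCont_tendsto_nhds_compose[OF has_fps_expansion_imp_analytic_0[OF
      eval_fps_has_fps_expansion[OF assms(2)]] this]
  show ?thesis by (simp add: eval_fps_at_0)
qed

lemma tendsto_puiseux_eval:
  assumes "\<gamma> \<in> P_plus h"
  shows "(puiseux_eval \<gamma> \<longlongrightarrow> 0) (at_right 0)"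
proof -
  obtain n \<Psi> where \<gamma>: "\<gamma> = (n, \<Psi>)" by fastforce
  note P = P_plus_props[OF assms[unfolded \<gamma>]]
  show ?thesis
    using tendsto_Re[OF tendsto_eval_fps_root[OF P(1,2)]] P(3)
    by (simp add: puiseux_eval_def[abs_def] \<gamma>)
qed

lemma bipoly_puiseux_eval:
  assumes "\<gamma> \<in> P_plus h"
  shows "\<forall>\<^sub>F x in at_right 0. bipoly h x (puiseux_eval \<gamma> x) = 0"
proof -
  obtain n \<Psi> where \<gamma>: "\<gamma> = (n, \<Psi>)" by fastforce
  note P = P_plus_props[OF assms[unfolded \<gamma>]]
  have "(\<lambda>t. bipoly (complex_bipoly h) (t ^ n) (eval_fps \<Psi> t)) has_fps_expansion 0"
    using has_fps_expansion_bipoly[OF has_fps_expansion_fps_X_power[of n] eval_fps_has_fps_expansion[OF P(2)], of h]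
    by (simp add: P(5))
  then have "\<forall>\<^sub>F t in nhds 0. bipoly (complex_bipoly h) (t ^ n) (eval_fps \<Psi> t) = 0"
    by (simp add: has_fps_expansion_0_iff)
  moreover have "((\<lambda>x. complex_of_real (root n x)) \<longlongrightarrow> 0) (at_right 0)"
    using filterlim_root_at_right[OF P(1)] tendsto_of_real[of "root n" 0 "at_right 0"]
    by (simp add: filterlim_at)
  ultimately have "\<forall>\<^sub>F x in at_right 0. bipoly (complex_bipoly h) (of_real (root n x) ^ n) (eval_fps \<Psi> (of_real (root n x))) = 0"
    by (rule eventually_compose_filterlim)
  with puiseux_eval_complex[OF assms] eventually_at_right_less[of "0::real"] show ?thesis
  proof eventually_elim
    case (elim x)
    have "complex_of_real (root n x) ^ n = of_real x"
      using elim(2) P(1) by (simp flip: of_real_power)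
    then have "bipoly (complex_bipoly h) (of_real x) (of_real (puiseux_eval \<gamma> x)) = 0"
      using elim(1,3) by (simp add: \<gamma>)
    then show ?case by (simp add: bipoly_complex_of_real)
  qed
qed

text \<open>Dividing the exponents of \<open>\<Psi>\<close> and \<open>N\<close> by their greatest common divisor.\<close>

lemma puiseux_root_normalize:
  assumes N: "N > 0" and rad: "fps_conv_radius \<Psi> > 0" and low: "\<And>k. k < N \<Longrightarrow> fps_nth \<Psi> k = 0"
    and re: "\<And>k. fps_nth \<Psi> k \<in> \<real>"
    and zero: "bipoly (map_poly (map_poly fps_const) (complex_bipoly h)) (fps_X ^ N) \<Psi> = 0"
  obtains \<gamma> where "\<gamma> \<in> P_plus h"
    "\<forall>\<^sub>F x in at_right 0. complex_of_real (puiseux_eval \<gamma> x) = eval_fps \<Psi> (of_real (root N x))"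
proof -
  define g where "g = Gcd (insert N {k. fps_nth \<Psi> k \<noteq> 0})"
  have gN: "g dvd N" unfolding g_def by (rule Gcd_dvd) simp
  have gk: "g dvd k" if "fps_nth \<Psi> k \<noteq> 0" for k unfolding g_def by (rule Gcd_dvd) (use that in simp)
  have g: "g > 0" using gN N by (metis dvd_0_left_iff gr0I not_gr0)
  define n where "n = N div g"
  have Nn: "N = g * n" using gN by (simp add: n_def)
  have n: "n > 0" using N Nn by (cases n) auto
  define \<Phi> where "\<Phi> = Abs_fps (\<lambda>k. fps_nth \<Psi> (g * k))"
  have comp: "\<Phi> oo fps_X ^ g = \<Psi>"
    by (rule fps_ext) (use gk in \<open>auto simp: fps_nth_compose_X_power \<Phi>_def\<close>)
  \<comment> \<open>The terms of \<Phi> at R^g are among the terms of \<Psi> at R, which converge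
    absolutely.\<close>
  have rad': "fps_conv_radius \<Phi> > 0"
  proof -
    obtain R where R: "0 < ereal R" "ereal R < fps_conv_radius \<Psi>"
      using rad ereal_dense2 by blast
    have "summable (\<lambda>k. norm (fps_nth \<Psi> k * of_real R ^ k))"
      by (rule norm_summable_fps) (use R in simp)
    then have "summable ((\<lambda>k. norm (fps_nth \<Psi> k * of_real R ^ k)) \<circ> (\<lambda>k. g * k))"
      by (rule summable_reindex) (use g in \<open>auto simp: inj_on_def\<close>)
    then have "summable (\<lambda>k. norm (fps_nth \<Phi> k * (of_real R ^ g) ^ k))"
      by (simp add: o_def \<Phi>_def power_mult)
    then have "summable (\<lambda>k. fps_nth \<Phi> k * (of_real R ^ g) ^ k)"
      by (rule summable_norm_cancel)
    then have "ereal (norm (complex_of_real R ^ g)) \<le> fps_conv_radius \<Phi>"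
      unfolding fps_conv_radius_def by (rule conv_radius_geI)
    moreover have "0 < ereal (norm (complex_of_real R ^ g))" using R(1) by (simp add: norm_power)
    ultimately show ?thesis by (rule less_le_trans[rotated])
  qed
  have X0: "fps_nth (fps_X ^ g :: complex fps) 0 = 0" using g by simp
  have XG: "fps_X oo fps_X ^ g = (fps_X ^ g :: complex fps)"
    by (rule fps_X_fps_compose_startby0[OF X0])
  \<comment> \<open>Substituting X^g into a formal series is injective, so the root property
    descends from \<Psi> to \<Phi>.\<close>
  have "(bipoly (map_poly (map_poly fps_const) (complex_bipoly h)) (fps_X ^ n) \<Phi>) oo fps_X ^ g =
      bipoly (map_poly (map_poly fps_const) (complex_bipoly h)) (fps_X ^ N) \<Psi>"
    unfolding bipoly_fps
    by (simp add: fps_compose_sum_distrib fps_compose_mult_distrib[OF X0] comp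
        XG flip: fps_compose_power[OF X0]) (simp add: Nn power_mult)
  then have "bipoly (map_poly (map_poly fps_const) (complex_bipoly h)) (fps_X ^ n) \<Phi> = 0"
    using zero X0 by (simp add: fps_compose_eq_0_iff)
  moreover have "Gcd (insert n {k. fps_nth \<Phi> k \<noteq> 0}) = 1"
  proof -
    have "insert N {k. fps_nth \<Psi> k \<noteq> 0} = (*) g ` insert n {k. fps_nth \<Phi> k \<noteq> 0}"
      using gk by (auto simp: Nn \<Phi>_def image_iff dvd_def)
    then have "g = g * Gcd (insert n {k. fps_nth \<Phi> k \<noteq> 0})"
      unfolding g_def[symmetric] by (metis Gcd_mult g_def normalize_nat_def id_apply)
    then show ?thesis using g by simp
  qed
  ultimately have \<gamma>: "(n, \<Phi>) \<in> P_plus h"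
    using n rad' low re g
    by (auto simp: P_plus_def puiseux_roots_def puiseux_series_def real_puiseux_def \<Phi>_def Nn)
  have "(eval_fps \<Phi> \<circ> (\<lambda>z. z ^ g)) has_fps_expansion (\<Phi> oo fps_X ^ g)"
    using eval_fps_has_fps_expansion[OF rad'] X0 by (intro has_fps_expansion_compose fps_expansion_intros)
  then have "\<forall>\<^sub>F z in nhds 0. eval_fps \<Psi> z = eval_fps \<Phi> (z ^ g)"
    by (simp add: comp has_fps_expansion_def)
  moreover have "((\<lambda>x. complex_of_real (root N x)) \<longlongrightarrow> 0) (at_right 0)"
    using filterlim_root_at_right[OF N] tendsto_of_real[of "root N" 0 "at_right 0"]
    by (simp add: filterlim_at)
  ultimately have "\<forall>\<^sub>F x in at_right 0. eval_fps \<Psi> (of_real (root N x)) = eval_fps \<Phi> (of_real (root N x) ^ g)"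
    by (rule eventually_compose_filterlim)
  with puiseux_eval_complex[OF \<gamma>] eventually_at_right_less[of "0::real"]
  have "\<forall>\<^sub>F x in at_right 0. complex_of_real (puiseux_eval (n, \<Phi>) x) = eval_fps \<Psi> (of_real (root N x))"
  proof eventually_elim
    case (elim x)
    have "root N x ^ g = root n x"
      using elim(2) g by (simp add: Nn real_root_mult_exp real_root_ge_zero)
    then show ?case using elim by (simp flip: of_real_power)
  qed
  with \<gamma> show ?thesis using that by blast
qed

text \<open>If \<Psi> had order e < N, then in h(t^N, \<Psi>) the monomial y^m would have order m e,
  and every other monomial x^i y^j with i + j \<ge> m an order of at least N i + e j > m e, so that
  nothing could cancel the former. This yields the lower bound on the exponents in
  \<open>puiseux_series\<close>.\<close>

lemma puiseux_root_order:
  assumes vanish: "\<And>i j. i + j < m \<Longrightarrow> coeff (coeff h j) i = 0"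
    and lead: "coeff (coeff h m) 0 \<noteq> 0" and \<Psi>0: "fps_nth \<Psi> 0 = 0"
    and zero: "bipoly (map_poly (map_poly fps_const) (complex_bipoly h)) (fps_X ^ N) \<Psi> = 0"
    and k: "k < N"
  shows "fps_nth \<Psi> k = 0"
proof (rule ccontr)
  assume nz: "fps_nth \<Psi> k \<noteq> 0"
  define e where "e = subdegree \<Psi>"
  have \<Psi>: "\<Psi> \<noteq> 0" using nz by auto
  have "e < N" using nz k unfolding e_def by (meson le_less_trans subdegree_leI)
  have "e > 0" using \<Psi> \<Psi>0 nth_subdegree_nonzero[of \<Psi>] by (cases "subdegree \<Psi>") (auto simp: e_def)
  have lead': "fps_nth (\<Psi> ^ m) (m * e) \<noteq> 0"
    using nth_subdegree_nonzero[of "\<Psi> ^ m"] \<Psi> by (simp add: e_def)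
  have m: "m \<le> degree h" using lead by (intro le_degree) auto
  have term_eq: "fps_nth (fps_const (complex_of_real (coeff (coeff h j) i)) * (fps_X ^ N) ^ i * \<Psi> ^ j) (m * e) =
      (if j = m then if i = 0 then of_real (coeff (coeff h m) 0) * fps_nth (\<Psi> ^ m) (m * e) else 0 else 0)" for i j
  proof (cases "i + j < m \<or> (i = 0 \<and> j = m)")
    case True
    then show ?thesis using vanish by auto
  next
    case False
    then have ij: "i + j \<ge> m" "i = 0 \<Longrightarrow> j > m" by auto
    have "m * e < N * i + j * e"
    proof (cases "i = 0")
      case True
      then show ?thesis using ij(2) \<open>e > 0\<close> by simp
    next
      case i: False
      have "m * e \<le> (i + j) * e" using ij(1) by simp
      also have "\<dots> < i + (i + j) * e" using i by simp
      also have "\<dots> = (e + 1) * i + j * e" by (simp add: algebra_simps)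
      also have "\<dots> \<le> N * i + j * e" using \<open>e < N\<close> by (intro add_mono mult_le_mono) auto
      finally show ?thesis .
    qed
    then have "fps_nth (fps_X ^ (N * i) * \<Psi> ^ j) (m * e) = 0"
      by (auto simp: fps_X_power_mult_nth e_def intro!: nth_less_subdegree_zero)
    then have "fps_nth (fps_const (complex_of_real (coeff (coeff h j) i)) * (fps_X ^ N) ^ i * \<Psi> ^ j) (m * e) = 0"
      by (simp add: mult.assoc flip: power_mult)
    then show ?thesis using False by auto
  qed
  have "0 = fps_nth (bipoly (map_poly (map_poly fps_const) (complex_bipoly h)) (fps_X ^ N) \<Psi>) (m * e)"
    using zero by simp
  also have "\<dots> = (\<Sum>j\<le>degree h. \<Sum>i\<le>degree (coeff h j).
      fps_nth (fps_const (complex_of_real (coeff (coeff h j) i)) * (fps_X ^ N) ^ i * \<Psi> ^ j) (m * e))"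
    by (simp only: bipoly_fps fps_sum_nth sum_distrib_right)
  also have "\<dots> = (\<Sum>j\<le>degree h. if j = m then of_real (coeff (coeff h m) 0) * fps_nth (\<Psi> ^ m) (m * e) else 0)"
    unfolding term_eq by (intro sum.cong) auto
  also have "\<dots> = of_real (coeff (coeff h m) 0) * fps_nth (\<Psi> ^ m) (m * e)"
    using m by simp
  finally show False using lead lead' by simp
qed

text \<open>The algorithm gives a complex branch that meets the sequence infinitely often. The
  common points accumulate at 0 and so determine it: its constant term is 0 because y tends to 0,
  its coefficients are real because y is real, and it is a root of h because the points are zeros of
  h.\<close>

lemma puiseux_roots_cover_sequence:
  fixes t y :: "nat \<Rightarrow> real"
  assumes vanish: "\<And>i j. i + j < m \<Longrightarrow> coeff (coeff h j) i = 0"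
    and lead: "coeff (coeff h m) 0 \<noteq> 0"
    and t: "filterlim t (at_right 0) sequentially" and y: "y \<longlonglongrightarrow> 0"
    and zero: "\<forall>\<^sub>F k in sequentially. bipoly h (t k) (y k) = 0"
  obtains \<gamma> where "\<gamma> \<in> P_plus h" "\<exists>\<^sub>F k in sequentially. y k = puiseux_eval \<gamma> (t k)"
proof -
  define H where "H j z = (\<Sum>i\<le>degree (coeff h j). complex_of_real (coeff (coeff h j) i) * z ^ i)" for j z
  have H0: "H j 0 = of_real (coeff (coeff h j) 0)" for j
    by (simp add: H_def power_0_left if_distrib cong: if_cong)
  have "\<exists>N>0. \<exists>\<psi>. \<psi> analytic_on {0} \<and>
    (\<exists>\<^sub>F k in sequentially. complex_of_real (y k) = \<psi> (of_real (root N (t k))))"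
  proof (rule puiseux_branch_along_sequence[OF _ _ _ _ t])
    show "H j analytic_on {0}" for j
      unfolding H_def by (intro analytic_intros)
    show "H j 0 = 0" if "j < m" for j using vanish[of 0 j] that by (simp add: H0)
    show "H m 0 \<noteq> 0" using lead by (simp add: H0)
    show "m \<le> degree h" using lead by (intro le_degree) auto
    show "(\<lambda>k. complex_of_real (y k)) \<longlonglongrightarrow> 0" using tendsto_of_real[OF y] by simp
    show "\<forall>\<^sub>F k in sequentially. (\<Sum>j\<le>degree h. H j (of_real (t k)) * of_real (y k) ^ j) = 0"
      using zero by eventually_elim
        (simp add: H_def flip: bipoly_complex, simp add: bipoly_complex_of_real)
  qed
  then obtain N \<psi> where N: "N > 0" and \<psi>: "\<psi> analytic_on {0}"
    and fr: "\<exists>\<^sub>F k in sequentially. complex_of_real (y k) = \<psi> (of_real (root N (t k)))"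
    by blast
  obtain \<Psi> where \<Psi>: "\<psi> has_fps_expansion \<Psi>"
    using analytic_at_imp_has_fps_expansion_0[OF \<psi>] by blast
  then have rad: "fps_conv_radius \<Psi> > 0" and ev: "\<forall>\<^sub>F z in nhds 0. eval_fps \<Psi> z = \<psi> z"
    by (auto simp: has_fps_expansion_def)
  define s where "s k = root N (t k)" for k
  have s: "filterlim s (at_right 0) sequentially"
    unfolding s_def by (rule filterlim_compose[OF filterlim_root_at_right[OF N] t])
  then have s': "filterlim s (at 0) sequentially"
    by (rule filterlim_mono) (auto simp: at_le)
  then have "s \<longlonglongrightarrow> 0" "\<forall>\<^sub>F k in sequentially. s k \<noteq> 0" by (auto simp: filterlim_at)
  then have sc: "filterlim (\<lambda>k. complex_of_real (s k)) (at 0) sequentially"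
    using tendsto_of_real[of s 0 sequentially, where 'a = complex] by (simp add: filterlim_at)
  then have sc0: "(\<lambda>k. complex_of_real (s k)) \<longlonglongrightarrow> 0" by (simp add: filterlim_at)
  have fr_eval: "\<exists>\<^sub>F k in sequentially. complex_of_real (y k) = eval_fps \<Psi> (of_real (s k))"
    by (rule frequently_rev_mp[OF fr])
      (use eventually_compose_filterlim[OF ev sc0] in \<open>auto simp: s_def elim: eventually_mono\<close>)
  have \<Psi>0: "fps_nth \<Psi> 0 = 0"
  proof (rule ccontr)
    assume nz: "fps_nth \<Psi> 0 \<noteq> 0"
    have "(\<lambda>k. eval_fps \<Psi> (of_real (s k)) - of_real (y k)) \<longlonglongrightarrow> eval_fps \<Psi> 0 - of_real 0"
      by (intro tendsto_diff tendsto_of_real y isCont_tendsto_nhds_compose[OF _ sc0]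
          has_fps_expansion_imp_analytic_0[OF eval_fps_has_fps_expansion[OF rad]])
    then have "\<forall>\<^sub>F k in sequentially. eval_fps \<Psi> (of_real (s k)) - of_real (y k) \<noteq> 0"
      by (rule tendsto_imp_eventually_ne) (use nz in \<open>simp add: eval_fps_at_0\<close>)
    then have "\<forall>\<^sub>F k in sequentially. complex_of_real (y k) \<noteq> eval_fps \<Psi> (of_real (s k))"
      by eventually_elim auto
    then show False using fr_eval by (simp add: frequently_def)
  qed
  have re: "fps_nth \<Psi> k \<in> \<real>" for k
    by (rule fps_real_if_frequently_real[OF rad s'])
      (rule frequently_elim1[OF fr_eval], metis Reals_of_real)
  have expansion: "(\<lambda>z. bipoly (complex_bipoly h) (z ^ N) (eval_fps \<Psi> z)) has_fps_expansion
      bipoly (map_poly (map_poly fps_const) (complex_bipoly h)) (fps_X ^ N) \<Psi>"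
    by (intro has_fps_expansion_bipoly has_fps_expansion_fps_X_power eval_fps_has_fps_expansion rad)
  have "\<exists>\<^sub>F k in sequentially. bipoly (complex_bipoly h) (of_real (s k) ^ N) (eval_fps \<Psi> (of_real (s k))) = 0"
  proof (rule frequently_rev_mp[OF fr_eval])
    have "\<forall>\<^sub>F k in sequentially. t k > 0"
      using t by (auto simp: filterlim_at elim: eventually_mono)
    with zero show "\<forall>\<^sub>F k in sequentially. complex_of_real (y k) = eval_fps \<Psi> (of_real (s k)) \<longrightarrow>
        bipoly (complex_bipoly h) (of_real (s k) ^ N) (eval_fps \<Psi> (of_real (s k))) = 0"
    proof eventually_elim
      case (elim k)
      have "complex_of_real (s k) ^ N = of_real (t k)"
        using elim(2) N by (simp add: s_def flip: of_real_power)
      then show ?case using elim(1) by (metis bipoly_complex_of_real of_real_0)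
    qed
  qed
  then have "\<forall>\<^sub>F z in nhds 0. bipoly (complex_bipoly h) (z ^ N) (eval_fps \<Psi> z) = 0"
    by (rule analytic_frequently_zero[OF has_fps_expansion_imp_analytic_0[OF expansion] sc])
  then have id: "bipoly (map_poly (map_poly fps_const) (complex_bipoly h)) (fps_X ^ N) \<Psi> = 0"
    using expansion has_fps_expansion_0_iff fps_expansion_unique_complex by blast
  obtain \<gamma> where \<gamma>: "\<gamma> \<in> P_plus h" and
    ev\<gamma>: "\<forall>\<^sub>F x in at_right 0. complex_of_real (puiseux_eval \<gamma> x) = eval_fps \<Psi> (of_real (root N x))"
    using puiseux_root_normalize[OF N rad puiseux_root_order[OF vanish lead \<Psi>0 id] re id] by blast
  have "\<exists>\<^sub>F k in sequentially. y k = puiseux_eval \<gamma> (t k)"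
    by (rule frequently_rev_mp[OF fr_eval], rule eventually_mono[OF eventually_compose_filterlim[OF ev\<gamma> t]])
      (metis of_real_eq_iff s_def)
  with \<gamma> show ?thesis using that by blast
qed

section \<open>Limits of the quotient along a branch\<close>

text \<open>With A = t^a u and B = t^b w the quotient is t^(a - b) times a function tending to u(0)
  / w(0), which is nonzero. If a < b, this number is real as a limit of real values, and its sign
  distinguishes \<infinity> from -\<infinity>.\<close>

lemma analytic_quotient_limit:
  fixes q :: "real \<Rightarrow> real"
  assumes A: "A analytic_on {0}" and B: "B analytic_on {0}"
    and q: "\<forall>\<^sub>F t in at_right 0. B (of_real t) \<noteq> 0 \<and> of_real (q t) * B (of_real t) = A (complex_of_real t)"
  obtains L where "((\<lambda>t. ereal (q t)) \<longlongrightarrow> L) (at_right 0)"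
proof -
  have lim: "((\<lambda>t. complex_of_real t) \<longlongrightarrow> 0) (at_right 0)"
    using tendsto_of_real[OF tendsto_ident_at, of 0 "{0<..}"] by simp
  have pos: "\<forall>\<^sub>F t::real in at_right 0. t > 0" by (rule eventually_at_right_less)
  have "\<not> (\<forall>\<^sub>F t in nhds 0. B t = 0)"
  proof
    assume "\<forall>\<^sub>F t in nhds 0. B t = 0"
    from eventually_compose_filterlim[OF this lim] q have "\<forall>\<^sub>F t::real in at_right 0. False"
      by eventually_elim simp
    then show False by simp
  qed
  then obtain b w where w: "w analytic_on {0}" "w 0 \<noteq> 0" and Bw: "\<forall>\<^sub>F t in nhds 0. B t = t ^ b * w t"
    using analytic_factor_power[OF B] by blast
  show ?thesis
  proof (cases "\<forall>\<^sub>F t in nhds 0. A t = 0")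
    case True
    from eventually_compose_filterlim[OF True lim] q have "\<forall>\<^sub>F t in at_right 0. ereal (q t) = 0"
      by eventually_elim auto
    then show ?thesis by (rule that[OF tendsto_eventually])
  next
    case False
    then obtain a u where u: "u analytic_on {0}" "u 0 \<noteq> 0" and Au: "\<forall>\<^sub>F t in nhds 0. A t = t ^ a * u t"
      using analytic_factor_power[OF A] by blast
    define v where "v t = u (complex_of_real t) / w (of_real t)" for t
    have v: "(v \<longlongrightarrow> u 0 / w 0) (at_right 0)"
      unfolding v_def by (intro tendsto_divide isCont_tendsto_nhds_compose[OF _ lim] u w)
    have w0: "\<forall>\<^sub>F t in at_right 0. w (complex_of_real t) \<noteq> 0"
      using isCont_tendsto_nhds_compose[OF w(1) lim] w(2) by (rule tendsto_imp_eventually_ne)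
    have eq: "\<forall>\<^sub>F t in at_right 0. complex_of_real (q t) * of_real t ^ b = of_real t ^ a * v t"
      using eventually_compose_filterlim[OF Au lim] eventually_compose_filterlim[OF Bw lim] q w0
      by eventually_elim (auto simp: v_def field_simps)
    show ?thesis
    proof (cases "b \<le> a")
      case True
      have "((\<lambda>t. Re (of_real t ^ (a - b) * v t)) \<longlongrightarrow> Re (0 ^ (a - b) * (u 0 / w 0))) (at_right 0)"
        by (intro tendsto_intros lim v)
      moreover have "\<forall>\<^sub>F t in at_right 0. Re (of_real t ^ (a - b) * v t) = q t"
        using eq pos
      proof eventually_elim
        case (elim t)
        have "complex_of_real t ^ a = of_real t ^ (a - b) * of_real t ^ b"
          using True by (simp flip: power_add)
        then have "complex_of_real (q t) = of_real t ^ (a - b) * v t"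
          using elim by simp
        then show ?case by (metis Re_complex_of_real)
      qed
      ultimately have "(q \<longlongrightarrow> Re (0 ^ (a - b) * (u 0 / w 0))) (at_right 0)"
        by (rule Lim_transform_eventually)
      then show ?thesis by (rule that[OF tendsto_ereal])
    next
      case False
      define r where "r t = q t * t ^ (b - a)" for t
      have rv: "\<forall>\<^sub>F t in at_right 0. v t = of_real (r t)"
        using eq pos
      proof eventually_elim
        case (elim t)
        have "complex_of_real t ^ b = of_real t ^ (b - a) * of_real t ^ a"
          using False by (simp flip: power_add)
        then show ?case using elim by (simp add: r_def)
      qed
      have "((\<lambda>t. complex_of_real (r t)) \<longlongrightarrow> u 0 / w 0) (at_right 0)"
        using v rv by (rule Lim_transform_eventually)
      from tendsto_Re[OF this] tendsto_Im[OF this]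
      have r: "(r \<longlongrightarrow> Re (u 0 / w 0)) (at_right 0)" and "Im (u 0 / w 0) = 0"
        by (simp_all add: tendsto_const_iff)
      moreover have "u 0 / w 0 \<noteq> 0" using u w by simp
      ultimately have c: "Re (u 0 / w 0) \<noteq> 0" by (metis complex_eq_iff zero_complex.simps)
      have "((\<lambda>t::real. t ^ (b - a)) \<longlongrightarrow> 0 ^ (b - a)) (at_right 0)"
        by (intro tendsto_intros)
      then have "filterlim (\<lambda>t::real. inverse (t ^ (b - a))) at_top (at_right 0)"
        using False pos by (intro filterlim_inverse_at_top) (auto simp: power_0_left elim!: eventually_mono)
      then have top: "filterlim (\<lambda>t. r t * inverse (t ^ (b - a))) (if Re (u 0 / w 0) > 0 then at_top else at_bot) (at_right 0)"
        using filterlim_tendsto_pos_mult_at_top[OF r] filterlim_tendsto_neg_mult_at_bot[OF r] c by auto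
      have rq: "\<forall>\<^sub>F t in at_right 0. r t * inverse (t ^ (b - a)) = q t"
        using pos by eventually_elim (simp add: r_def)
      have "filterlim q (if Re (u 0 / w 0) > 0 then at_top else at_bot) (at_right 0)"
        by (rule filterlim_cong[OF refl refl rq, THEN iffD1, OF top])
      then show ?thesis
        using that[of \<infinity>] that[of "-\<infinity>"]
        by (simp add: tendsto_PInfty_eq_at_top tendsto_MInfty filterlim_at_bot_dense split: if_splits)
    qed
  qed
qed

lemma isolated_zero_along:
  assumes g: "isolated_zero g" and "(p \<longlongrightarrow> 0) F" "(q \<longlongrightarrow> 0) F" "\<forall>\<^sub>F x in F. p x \<noteq> 0"
  shows "\<forall>\<^sub>F x in F. bipoly g (p x) (q x) \<noteq> 0"
proof -
  have "filterlim (\<lambda>x. (p x, q x)) (at (0, 0)) F"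
    unfolding filterlim_at using assms by (auto intro: tendsto_Pair elim: eventually_mono)
  moreover have "\<forall>\<^sub>F z in at (0, 0). bipoly g (fst z) (snd z) \<noteq> 0"
    using g by (simp add: Defs.isolated_zero_def case_prod_unfold)
  ultimately show ?thesis
    using eventually_compose_filterlim by fastforce
qed

lemma branch_nonzero:
  assumes "isolated_zero g" "s \<noteq> 0" "\<gamma> \<in> P_plus h"
  shows "\<forall>\<^sub>F x in at_right 0. bipoly g (s * x) (puiseux_eval \<gamma> x) \<noteq> 0"
proof (rule isolated_zero_along[OF assms(1) _ tendsto_puiseux_eval[OF assms(3)]])
  have "((\<lambda>x. s * x) \<longlongrightarrow> s * 0) (at_right 0)"
    by (intro tendsto_intros)
  then show "((\<lambda>x. s * x) \<longlongrightarrow> 0) (at_right 0)"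
    by simp
  show "\<forall>\<^sub>F x in at_right 0. s * x \<noteq> 0"
    using eventually_at_right_less[of "0::real"] by eventually_elim (use assms in simp)
qed

text \<open>The substitution x = t^n leaves a quotient of functions analytic at 0. Convergence,
  reality and zero constant term of \<gamma> come from \<open>P_plus h\<close>; with h and s left
  general, the statement serves F with s = 1 and its reflection with s = -1.\<close>

lemma branch_quotient_tendsto:
  assumes g: "isolated_zero g" and s: "s \<noteq> 0" and \<gamma>: "\<gamma> \<in> P_plus h"
  shows "(branch_quotient f g s \<gamma> \<longlongrightarrow> branch_limit f g s \<gamma>) (at_right 0)"
proof -
  obtain n \<Psi> where \<gamma>_eq: "\<gamma> = (n, \<Psi>)" by fastforce
  note P = P_plus_props[OF \<gamma>[unfolded \<gamma>_eq]]
  define q where "q t = bipoly f (s * t ^ n) (Re (eval_fps \<Psi> (complex_of_real t))) /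
      bipoly g (s * t ^ n) (Re (eval_fps \<Psi> (complex_of_real t)))" for t :: real
  define E where "E p z = bipoly (complex_bipoly p) (of_real s * z ^ n) (eval_fps \<Psi> z)" for p z
  have E: "E p analytic_on {0}" for p
    unfolding E_def bipoly_complex
    by (intro analytic_intros has_fps_expansion_imp_analytic_0[OF eval_fps_has_fps_expansion[OF P(2)]])
  have fpow: "filterlim (\<lambda>t::real. t ^ n) (at_right 0) (at_right 0)"
    unfolding filterlim_at
  proof
    show "\<forall>\<^sub>F t::real in at_right 0. t ^ n \<in> {0<..} \<and> t ^ n \<noteq> 0"
      using eventually_at_right_less[of "0::real"] by eventually_elim simp
    have "((\<lambda>t::real. t ^ n) \<longlongrightarrow> 0 ^ n) (at_right 0)"
      by (intro tendsto_intros)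
    then show "((\<lambda>t::real. t ^ n) \<longlongrightarrow> 0) (at_right 0)"
      using P(1) by (simp add: power_0_left)
  qed
  have rn: "\<forall>\<^sub>F t in at_right 0. root n (t ^ n) = t"
    using eventually_at_right_less[of "0::real"] P(1)
    by (auto elim!: eventually_mono intro!: real_root_power_cancel)
  have "\<forall>\<^sub>F t in at_right 0. E g (of_real t) \<noteq> 0 \<and> of_real (q t) * E g (of_real t) = E f (complex_of_real t)"
    using eventually_compose_filterlim[OF branch_nonzero[OF g s \<gamma>] fpow]
      eventually_compose_filterlim[OF puiseux_eval_complex[OF \<gamma>] fpow] rn
  proof eventually_elim
    case (elim t)
    define z where "z = puiseux_eval \<gamma> (t ^ n)"
    have z: "eval_fps \<Psi> (of_real t) = of_real z"
      using elim(2,3) by (simp add: \<gamma>_eq z_def)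
    have "E p (of_real t) = of_real (bipoly p (s * t ^ n) z)" for p
      unfolding E_def z using bipoly_complex_of_real[of p "s * t ^ n" z] by simp
    moreover have "q t = bipoly f (s * t ^ n) z / bipoly g (s * t ^ n) z"
      by (simp add: q_def z)
    ultimately show ?case using elim(1) by (simp add: z_def)
  qed
  then obtain L where L: "((\<lambda>t. ereal (q t)) \<longlongrightarrow> L) (at_right 0)"
    using analytic_quotient_limit[OF E E] by blast
  have "((\<lambda>x. ereal (q (root n x))) \<longlongrightarrow> L) (at_right 0)"
    using filterlim_compose[OF L filterlim_root_at_right[OF P(1)]] .
  moreover have "\<forall>\<^sub>F x in at_right 0. ereal (q (root n x)) = branch_quotient f g s \<gamma> x"
    using eventually_at_right_less[of "0::real"]
    by eventually_elim (use P(1) in \<open>simp add: q_def branch_quotient_def puiseux_eval_def \<gamma>_eq\<close>)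
  ultimately have lim: "(branch_quotient f g s \<gamma> \<longlongrightarrow> L) (at_right 0)"
    by (rule Lim_transform_eventually)
  then have "branch_limit f g s \<gamma> = L"
    unfolding branch_limit_def by (intro tendsto_Lim) auto
  with lim show ?thesis by simp
qed

section \<open>Reflection, lowest-order coefficients and derivatives\<close>

lemma bipoly_pCons [simp]: "bipoly (pCons p h) x y = poly p x + y * bipoly h x y"
  by (simp add: bipoly_def)

lemma bipoly_0 [simp]: "bipoly 0 x y = 0"
  by (simp add: bipoly_def)

lemma bipoly_add: "bipoly (p + q) x y = bipoly p x y + bipoly q x y"
  by (simp add: bipoly_def)

lemma bipoly_sum_atMost:
  assumes "degree h \<le> n"
  shows "bipoly h x y = (\<Sum>j\<le>n. poly (coeff h j) x * y ^ j)"
  unfolding bipoly_altdef using assms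
  by (intro sum.mono_neutral_left) (auto simp: coeff_eq_0)

lemma bipoly_reflect_x: "bipoly (reflect_x h) x y = bipoly h (- x) y"
proof -
  have "degree (reflect_x h) \<le> degree h"
    unfolding reflect_x_def by (rule map_poly_degree_leq)
  then show ?thesis
    by (subst bipoly_sum_atMost[of _ "degree h"])
      (auto simp: bipoly_altdef reflect_x_def coeff_map_poly poly_pcompose)
qed

lemma coeff_reflect_x: "coeff (coeff (reflect_x h) j) i = (-1) ^ i * coeff (coeff h j) i"
  by (simp add: reflect_x_def coeff_map_poly coeff_pcompose_linear)

text \<open>At (0, 1) the component of lowest degree m reduces to its coefficient at y^m. The
  coefficient form is what comparisons of orders use.\<close>

lemma y_regular_coeffs:
  assumes "y_regular h"
  obtains m where "\<And>i j. i + j < m \<Longrightarrow> coeff (coeff h j) i = 0" "coeff (coeff h m) 0 \<noteq> 0"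
proof
  define m where "m = bipoly_ord h"
  have "bipoly (hom_component m h) 0 1 = (\<Sum>j\<le>m. coeff (coeff h j) (m - j) * 0 ^ (m - j))"
    by (simp add: hom_component_def bipoly_def poly_sum poly_monom)
  also have "\<dots> = (\<Sum>j\<le>m. if j = m then coeff (coeff h m) 0 else 0)"
    by (intro sum.cong) (auto simp: power_0_left)
  also have "\<dots> = coeff (coeff h m) 0" by simp
  finally show "coeff (coeff h (bipoly_ord h)) 0 \<noteq> 0"
    using assms by (simp add: y_regular_def m_def)
  fix i j assume "i + j < bipoly_ord h"
  then have "hom_component (i + j) h = 0"
    unfolding bipoly_ord_def using not_less_Least by blast
  then have "coeff (coeff (hom_component (i + j) h) j) i = 0" by simp
  moreover have "coeff (hom_component (i + j) h) j = monom (coeff (coeff h j) i) i"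
  proof -
    have "coeff (hom_component (i + j) h) j =
        (\<Sum>k\<le>i + j. if k = j then monom (coeff (coeff h k) (i + j - k)) (i + j - k) else 0)"
      by (simp add: hom_component_def coeff_sum if_distrib)
    then show ?thesis by simp
  qed
  ultimately show "coeff (coeff h j) i = 0" by simp
qed

lemma has_derivative_bipoly:
  "((\<lambda>z. bipoly h (fst z) (snd z)) has_derivative
    (\<lambda>v. bipoly (dx h) a b * fst v + bipoly (dy h) a b * snd v)) (at (a, b))"
proof (induction h)
  case 0
  then show ?case by (simp add: dx_def dy_def)
next
  case (pCons p h)
  have "((\<lambda>z. poly p (fst z)) has_derivative (\<lambda>v. poly (pderiv p) a * fst v)) (at (a, b))"
    using has_derivative_compose[OF has_derivative_fst[OF has_derivative_ident]
        poly_DERIV[of p "fst (a, b)", unfolded has_field_derivative_def], of UNIV]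
    by simp
  from has_derivative_add[OF this has_derivative_mult[OF has_derivative_snd[OF has_derivative_ident] pCons.IH]]
  show ?case
    unfolding bipoly_pCons by (rule has_derivative_eq_rhs)
      (simp add: fun_eq_iff dx_def dy_def map_poly_pCons pderiv_pCons bipoly_add algebra_simps)
qed

lemma continuous_on_bipoly:
  fixes h :: "real poly poly"
  shows "continuous_on S (\<lambda>z. bipoly h (fst z) (snd z))"
proof -
  have "isCont (\<lambda>z. bipoly h (fst z) (snd z)) z" for z
    using has_derivative_continuous[OF has_derivative_bipoly[of h "fst z" "snd z"]] by simp
  then show ?thesis by (simp add: continuous_at_imp_continuous_on)
qed

section \<open>Extrema of f on the level curves of g\<close>

lemma bipoly_jacobian:
  "bipoly (jacobian_poly f g) x y =
    bipoly (dx f) x y * bipoly (dy g) x y - bipoly (dy f) x y * bipoly (dx g) x y"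
  by (simp add: bipoly_def jacobian_poly_def)

text \<open>A nonzero Jacobian makes the derivative of (f, g) invertible, so the image of U contains
  a disc about the image of p. Moving in that disc parallel to the first axis changes f in both
  directions while g stays fixed.\<close>

lemma level_set_not_extremal:
  assumes J: "bipoly (jacobian_poly f g) (fst p) (snd p) \<noteq> 0" and U: "open U" "p \<in> U"
  obtains e where "e > 0" "\<And>d. \<bar>d\<bar> < e \<Longrightarrow> \<exists>z\<in>U. bipoly f (fst z) (snd z) = bipoly f (fst p) (snd p) + d \<and>
    bipoly g (fst z) (snd z) = bipoly g (fst p) (snd p)"
proof -
  obtain a b where p: "p = (a, b)" by fastforce
  define \<Phi> where "\<Phi> z = (bipoly f (fst z) (snd z), bipoly g (fst z) (snd z))" for z
  define fx fy gx gy where "fx = bipoly (dx f) a b" and "fy = bipoly (dy f) a b"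
    and "gx = bipoly (dx g) a b" and "gy = bipoly (dy g) a b"
  define D where "D = fx * gy - fy * gx"
  have D: "D \<noteq> 0" using J by (simp add: D_def p bipoly_jacobian fx_def fy_def gx_def gy_def)
  define \<Phi>' where "\<Phi>' v = (fx * fst v + fy * snd v, gx * fst v + gy * snd v)" for v
  \<comment> \<open>The inverse matrix by Cramer's rule.\<close>
  define \<Psi>' where "\<Psi>' v = ((gy * fst v - fy * snd v) / D, (fx * snd v - gx * fst v) / D)" for v :: "real \<times> real"
  have "\<Phi> p \<in> interior (\<Phi> ` U)"
  proof (rule sussmann_open_mapping[OF open_UNIV _ UNIV_I])
    show "continuous_on UNIV \<Phi>"
      unfolding \<Phi>_def by (intro continuous_on_Pair continuous_on_bipoly)
    show "(\<Phi> has_derivative \<Phi>') (at p)"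
      unfolding \<Phi>_def \<Phi>'_def p fx_def fy_def gx_def gy_def
      by (intro has_derivative_Pair has_derivative_bipoly)
    have "linear \<Psi>'"
      unfolding \<Psi>'_def by (intro linearI) (auto simp: algebra_simps add_divide_distrib diff_divide_distrib)
    then show "bounded_linear \<Psi>'" by (simp add: linear_conv_bounded_linear)
    show "\<Phi>' \<circ> \<Psi>' = id"
    proof
      fix v :: "real \<times> real"
      have "fx * (gy * fst v - fy * snd v) + fy * (fx * snd v - gx * fst v) = D * fst v"
        "gx * (gy * fst v - fy * snd v) + gy * (fx * snd v - gx * fst v) = D * snd v"
        by (simp_all add: D_def algebra_simps)
      then show "(\<Phi>' \<circ> \<Psi>') v = id v"
        using D by (simp add: \<Phi>'_def \<Psi>'_def flip: add_divide_distrib times_divide_eq_right)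
          (simp add: prod_eq_iff flip: add_divide_distrib)
    qed
  qed (use U in \<open>auto simp: interior_open\<close>)
  then obtain e where e: "e > 0" "ball (\<Phi> p) e \<subseteq> \<Phi> ` U"
    by (auto simp: mem_interior)
  show ?thesis
  proof (rule that[OF e(1)])
    fix d :: real assume d: "\<bar>d\<bar> < e"
    have "(fst (\<Phi> p) + d, snd (\<Phi> p)) \<in> ball (\<Phi> p) e"
      using d by (simp add: dist_prod_def dist_real_def)
    then obtain z where "z \<in> U" "\<Phi> z = (fst (\<Phi> p) + d, snd (\<Phi> p))"
      using e(2) by (metis imageE subsetD)
    then show "\<exists>z\<in>U. bipoly f (fst z) (snd z) = bipoly f (fst p) (snd p) + d \<and>
        bipoly g (fst z) (snd z) = bipoly g (fst p) (snd p)"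
      by (intro bexI[of _ z]) (simp_all add: \<Phi>_def)
  qed
qed

lemma isolated_zero_eventually:
  assumes "isolated_zero g"
  shows "bipoly g 0 0 = 0" "\<forall>\<^sub>F z in at (0, 0). bipoly g (fst z) (snd z) \<noteq> 0"
  using assms by (simp_all add: Defs.isolated_zero_def case_prod_unfold)

text \<open>Compactness of the closed disc of radius R provides extrema on its part of the level
  set. On the boundary circle |g| is at least \<mu> > 0, so for |g(z)| < \<mu> the level set misses
  the circle and the extrema are interior, where the open mapping argument applies.\<close>

lemma critical_points_on_level_set:
  fixes f g :: "real poly poly"
  defines "f' \<equiv> \<lambda>z. bipoly f (fst z) (snd z)" and "g' \<equiv> \<lambda>z. bipoly g (fst z) (snd z)"
    and "J \<equiv> \<lambda>z. bipoly (jacobian_poly f g) (fst z) (snd z)"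
  assumes g: "isolated_zero g" and e: "e > 0"
  shows "\<forall>\<^sub>F z in at (0, 0). \<exists>z1\<in>ball (0, 0) e. \<exists>z2\<in>ball (0, 0) e. J z1 = 0 \<and> J z2 = 0 \<and>
    g' z1 = g' z \<and> g' z2 = g' z \<and> f' z1 \<le> f' z \<and> f' z \<le> f' z2"
proof -
  obtain d where d: "d > 0" "\<And>z. z \<noteq> (0, 0) \<Longrightarrow> dist z (0, 0) < d \<Longrightarrow> g' z \<noteq> 0"
    using isolated_zero_eventually(2)[OF g] unfolding eventually_at g'_def by auto
  define R where "R = min d e / 2"
  have R: "R > 0" "R < d" "R < e" using d e by (auto simp: R_def)
  let ?S = "sphere (0, 0) R :: (real \<times> real) set"
  have cont: "continuous_on S f'" "continuous_on S g'" for S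
    unfolding f'_def g'_def by (rule continuous_on_bipoly)+
  have "(R, 0) \<in> ?S" using R by (simp add: dist_prod_def)
  then have "?S \<noteq> {}" by blast
  then obtain p where p: "p \<in> ?S" "\<And>z. z \<in> ?S \<Longrightarrow> \<bar>g' p\<bar> \<le> \<bar>g' z\<bar>"
    using continuous_attains_inf[OF compact_sphere, of _ _ "\<lambda>z. \<bar>g' z\<bar>"] cont
      continuous_on_rabs by metis
  define \<mu> where "\<mu> = \<bar>g' p\<bar>"
  have "\<mu> > 0" using d(2)[of p] p(1) R by (auto simp: \<mu>_def dist_commute)
  have "((\<lambda>z. \<bar>g' z\<bar>) \<longlongrightarrow> \<bar>g' (0, 0)\<bar>) (at (0, 0))"
    using cont(2)[of UNIV] by (intro tendsto_intros) (simp add: continuous_on_def)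
  then have "\<forall>\<^sub>F z in at (0, 0). \<bar>g' z\<bar> < \<mu>"
    using \<open>\<mu> > 0\<close> isolated_zero_eventually(1)[OF g] by (intro order_tendstoD(2)) (auto simp: g'_def)
  moreover have "\<forall>\<^sub>F z in at (0, 0). z \<in> ball (0, 0) R"
    using R by (intro eventually_at_in_open') auto
  ultimately show ?thesis
  proof eventually_elim
    case (elim z)
    define K where "K = {w \<in> cball (0, 0) R. g' w = g' z}"
    have "closed K"
      unfolding K_def Collect_conj_eq Collect_mem_eq
      by (intro closed_Int closed_cball closed_Collect_eq cont continuous_on_const)
    moreover have "bounded K"
      unfolding K_def using bounded_cball by (rule bounded_subset) auto
    ultimately have "compact K" by (simp add: compact_eq_bounded_closed)
    moreover have "z \<in> K" using elim(2) by (simp add: K_def)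
    ultimately obtain z1 z2 where z: "z1 \<in> K" "z2 \<in> K" "\<And>w. w \<in> K \<Longrightarrow> f' z1 \<le> f' w \<and> f' w \<le> f' z2"
      using continuous_attains_sup[of K f'] continuous_attains_inf[of K f'] cont(1) by blast
    have inner: "w \<in> ball (0, 0) R" if "w \<in> K" for w
      using that p(2)[of w] elim(1) by (auto simp: K_def \<mu>_def order_le_less)
    have Kball: "w \<in> K" if "w \<in> ball (0, 0) R" "g' w = g' z" for w
      using that by (simp add: K_def)
    \<comment> \<open>One formulation for minima and maxima. If the Jacobian were nonzero at w, some
      v' in K would have a smaller value of f, so w would have to be a maximum, which a point v in K
      with a larger value refutes.\<close>
    have crit: "J w = 0" if w: "w \<in> K" "\<And>v. v \<in> K \<Longrightarrow> f' w \<le> f' v \<or> (\<forall>v\<in>K. f' v \<le> f' w)" for w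
    proof (rule ccontr)
      assume "J w \<noteq> 0"
      then obtain \<epsilon> where \<epsilon>: "\<epsilon> > 0" "\<And>\<delta>. \<bar>\<delta>\<bar> < \<epsilon> \<Longrightarrow> \<exists>v\<in>ball (0, 0) R. f' v = f' w + \<delta> \<and> g' v = g' w"
        using level_set_not_extremal[OF _ open_ball inner[OF w(1)]] unfolding J_def f'_def g'_def by blast
      have "g' w = g' z" using w(1) by (simp add: K_def)
      moreover obtain v v' where "v \<in> ball (0, 0) R" "f' v = f' w + \<epsilon> / 2" "g' v = g' w"
        "v' \<in> ball (0, 0) R" "f' v' = f' w + - (\<epsilon> / 2)" "g' v' = g' w"
        using \<epsilon>(2)[of "\<epsilon> / 2"] \<epsilon>(2)[of "- (\<epsilon> / 2)"] \<epsilon>(1) by auto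
      ultimately have "v \<in> K" "v' \<in> K" "f' v > f' w" "f' v' < f' w"
        using Kball \<epsilon>(1) by auto
      then show False using w(2)[of v'] by force
    qed
    have "J z1 = 0" "J z2 = 0" using z by (auto intro!: crit)
    moreover have "z1 \<in> ball (0, 0) e" "z2 \<in> ball (0, 0) e"
      using inner[OF z(1)] inner[OF z(2)] R by auto
    ultimately show ?case
      using z \<open>z \<in> K\<close> by (intro bexI[of _ z1] bexI[of _ z2]) (auto simp: K_def)
  qed
qed

section \<open>From critical sequences to branch limits\<close>

lemma frequently_sequentially_subseq:
  assumes "\<exists>\<^sub>F n in sequentially. P n"
  obtains \<sigma> :: "nat \<Rightarrow> nat" where "strict_mono \<sigma>" "\<And>n. P (\<sigma> n)"
proof -
  have "infinite {n. P n}"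
    using assms by (simp add: frequently_cofinite flip: cofinite_eq_sequentially)
  then show ?thesis using that infinite_enumerate[of "{n. P n}"] by auto
qed

lemma bipoly_0_left_nonzero:
  assumes "coeff (coeff h m) 0 \<noteq> 0"
  shows "\<forall>\<^sub>F y in at 0. bipoly h 0 y \<noteq> (0::real)"
proof -
  define p where "p = map_poly (\<lambda>q. poly q 0) h"
  have "coeff p m \<noteq> 0" using assms by (simp add: p_def coeff_map_poly poly_0_coeff_0)
  then have "p \<noteq> 0" by auto
  then have "\<not> 0 islimpt {y. poly p y = 0}"
    by (intro islimpt_finite poly_roots_finite)
  moreover have "poly p y = bipoly h 0 y" for y
  proof -
    have "degree p \<le> degree h" unfolding p_def by (rule map_poly_degree_leq)
    then have "poly p y = (\<Sum>j\<le>degree h. coeff p j * y ^ j)"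
      unfolding poly_altdef by (intro sum.mono_neutral_left) (auto simp: coeff_eq_0)
    then show ?thesis by (simp add: bipoly_altdef p_def coeff_map_poly)
  qed
  ultimately show ?thesis by (simp add: islimpt_iff_eventually)
qed

text \<open>Near the origin the zeros of F other than the origin are off the y-axis, so infinitely
  many of the points lie on one side. After reflecting x if necessary they have x > 0, and a real
  branch contains a further subsequence.\<close>

lemma critical_sequence_branch_limit:
  fixes a b :: "nat \<Rightarrow> real"
  assumes g: "isolated_zero g" and J: "y_regular (jacobian_poly f g)"
    and a: "a \<longlonglongrightarrow> 0" and b: "b \<longlonglongrightarrow> 0"
    and nz: "\<And>n. bipoly g (a n) (b n) \<noteq> 0" and crit: "\<And>n. bipoly (jacobian_poly f g) (a n) (b n) = 0"
  obtains M \<sigma> where "M \<in> branch_limits f g" "strict_mono \<sigma>"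
    "(\<lambda>n. ereal (bipoly f (a (\<sigma> n)) (b (\<sigma> n)) / bipoly g (a (\<sigma> n)) (b (\<sigma> n)))) \<longlonglongrightarrow> M"
proof -
  define F where "F = jacobian_poly f g"
  obtain m where m: "\<And>i j. i + j < m \<Longrightarrow> coeff (coeff F j) i = 0" "coeff (coeff F m) 0 \<noteq> 0"
    using y_regular_coeffs[OF J] unfolding F_def by blast
  have "\<forall>\<^sub>F n in sequentially. a n \<noteq> 0"
  proof -
    have "\<forall>\<^sub>F y in nhds 0. y \<noteq> 0 \<longrightarrow> bipoly F 0 y \<noteq> 0"
      using bipoly_0_left_nonzero[OF m(2)] by (simp add: eventually_at_filter)
    from eventually_compose_filterlim[OF this b] show ?thesis
    proof eventually_elim
      case (elim n)
      show ?case
      proof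
        assume "a n = 0"
        moreover from this nz[of n] isolated_zero_eventually(1)[OF g] have "b n \<noteq> 0" by metis
        ultimately show False using elim crit[of n] by (simp add: F_def)
      qed
    qed
  qed
  \<comment> \<open>The factors 1 and -1 are written out so that the sign s can be read off from the
    disjunction.\<close>
  then have "\<exists>\<^sub>F n in sequentially. 1 * a n > 0 \<or> (-1) * a n > 0"
    by (intro eventually_frequently) (auto elim!: eventually_mono)
  then obtain s where s: "s = 1 \<or> s = -1" and "\<exists>\<^sub>F n in sequentially. s * a n > 0"
    unfolding frequently_disj_iff by blast
  then obtain \<sigma> :: "nat \<Rightarrow> nat" where \<sigma>: "strict_mono \<sigma>" "\<And>n. s * a (\<sigma> n) > 0"
    using frequently_sequentially_subseq by blast
  define h where "h = (if s = 1 then F else reflect_x F)"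
  have h: "bipoly h x y = bipoly F (s * x) y" for x y
    using s by (auto simp: h_def bipoly_reflect_x)
  have a\<sigma>: "(\<lambda>n. a (\<sigma> n)) \<longlonglongrightarrow> 0" and b\<sigma>: "(\<lambda>n. b (\<sigma> n)) \<longlonglongrightarrow> 0"
    using LIMSEQ_subseq_LIMSEQ[OF a \<sigma>(1)] LIMSEQ_subseq_LIMSEQ[OF b \<sigma>(1)] by (auto simp: o_def)
  define t where "t n = s * a (\<sigma> n)" for n
  have at: "a (\<sigma> n) = s * t n" for n using s by (auto simp: t_def)
  have "t \<longlonglongrightarrow> s * 0" unfolding t_def by (intro tendsto_intros a\<sigma>)
  moreover have tpos: "t n > 0" for n using \<sigma>(2) by (simp add: t_def)
  have "t n \<noteq> 0" for n using tpos[of n] by simp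
  ultimately have t: "filterlim t (at_right 0) sequentially"
    unfolding filterlim_at using tpos by simp
  obtain \<gamma> where \<gamma>: "\<gamma> \<in> P_plus h" and "\<exists>\<^sub>F n in sequentially. b (\<sigma> n) = puiseux_eval \<gamma> (t n)"
  proof (rule puiseux_roots_cover_sequence[OF _ _ t b\<sigma>])
    show "coeff (coeff h j) i = 0" if "i + j < m" for i j
      using m(1)[OF that] by (simp add: h_def coeff_reflect_x)
    show "coeff (coeff h m) 0 \<noteq> 0"
      using m(2) by (simp add: h_def coeff_reflect_x)
    show "\<forall>\<^sub>F k in sequentially. bipoly h (t k) (b (\<sigma> k)) = 0"
      using crit by (simp add: h F_def flip: at)
  qed blast
  then obtain \<tau> :: "nat \<Rightarrow> nat" where \<tau>: "strict_mono \<tau>" "\<And>n. b (\<sigma> (\<tau> n)) = puiseux_eval \<gamma> (t (\<tau> n))"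
    using frequently_sequentially_subseq by blast
  have "filterlim (\<lambda>n. t (\<tau> n)) (at_right 0) sequentially"
    by (rule filterlim_compose[OF t filterlim_subseq[OF \<tau>(1)]])
  from filterlim_compose[OF branch_quotient_tendsto[OF g _ \<gamma>] this]
  have "(\<lambda>n. branch_quotient f g s \<gamma> (t (\<tau> n))) \<longlonglongrightarrow> branch_limit f g s \<gamma>"
    using s by auto
  then have "(\<lambda>n. ereal (bipoly f (a ((\<sigma> \<circ> \<tau>) n)) (b ((\<sigma> \<circ> \<tau>) n)) /
      bipoly g (a ((\<sigma> \<circ> \<tau>) n)) (b ((\<sigma> \<circ> \<tau>) n)))) \<longlonglongrightarrow> branch_limit f g s \<gamma>"
    by (simp add: branch_quotient_def \<tau>(2) at)
  moreover have "strict_mono (\<sigma> \<circ> \<tau>)" using \<sigma>(1) \<tau>(1) by (rule strict_mono_o)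
  moreover have "branch_limit f g s \<gamma> \<in> branch_limits f g"
    using s \<gamma> by (auto simp: branch_limits_def P_minus_def h_def F_def)
  ultimately show ?thesis using that by blast
qed

section \<open>Finiteness of the set of branch limits\<close>

lemma eventually_neq_of_tendsto_neq:
  fixes L L' :: "'a::t2_space"
  assumes "(p \<longlongrightarrow> L) F" "(q \<longlongrightarrow> L') F" "L \<noteq> L'"
  shows "\<forall>\<^sub>F x in F. p x \<noteq> q x"
proof -
  obtain U V where UV: "open U" "open V" "L \<in> U" "L' \<in> V" "U \<inter> V = {}"
    using hausdorff[OF assms(3)] by blast
  have "\<forall>\<^sub>F x in F. p x \<in> U" "\<forall>\<^sub>F x in F. q x \<in> V"
    using UV assms by (auto dest: topological_tendstoD)
  then show ?thesis
    by eventually_elim (use UV in auto)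
qed

text \<open>Branches with different limits take different values at all small \<open>x > 0\<close>, and these values are roots
  of the nonzero polynomial \<open>h(x, \<cdot>)\<close>.\<close>

lemma finite_branch_limit_image:
  assumes g: "isolated_zero g" and s: "s \<noteq> 0" and h: "h \<noteq> 0"
  shows "finite (branch_limit f g s ` P_plus h)"
proof (rule ccontr)
  assume "infinite (branch_limit f g s ` P_plus h)"
  then obtain B where B: "finite B" "card B = Suc (degree h)" "B \<subseteq> branch_limit f g s ` P_plus h"
    using infinite_arbitrarily_large by blast
  then have "\<forall>L\<in>B. \<exists>\<gamma>\<in>P_plus h. branch_limit f g s \<gamma> = L" by blast
  then obtain \<gamma> where \<gamma>: "\<And>L. L \<in> B \<Longrightarrow> \<gamma> L \<in> P_plus h" "\<And>L. L \<in> B \<Longrightarrow> branch_limit f g s (\<gamma> L) = L"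
    by metis
  have lim: "(branch_quotient f g s (\<gamma> L) \<longlongrightarrow> L) (at_right 0)" if "L \<in> B" for L
    using branch_quotient_tendsto[OF g s \<gamma>(1)[OF that], of f] \<gamma>(2)[OF that] by simp
  have "\<forall>\<^sub>F x in at_right 0. \<forall>L\<in>B. bipoly h x (puiseux_eval (\<gamma> L) x) = 0"
    using B(1) \<gamma>(1) by (intro eventually_ball_finite ballI bipoly_puiseux_eval) auto
  moreover have "\<forall>\<^sub>F x in at_right 0. \<forall>L\<in>B. \<forall>L'\<in>B - {L}. branch_quotient f g s (\<gamma> L) x \<noteq> branch_quotient f g s (\<gamma> L') x"
    using B(1) by (intro eventually_ball_finite ballI eventually_neq_of_tendsto_neq[OF lim lim]) auto
  \<comment> \<open>Where the leading coefficient does not vanish, the polynomial in y at this x is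
    nonzero and has at most \<open>degree h\<close> roots, one fewer than the values to be
    exhibited.\<close>
  moreover have "\<forall>\<^sub>F x in at_right 0. poly (lead_coeff h) x \<noteq> 0"
  proof -
    have "finite {x. poly (lead_coeff h) x = 0}" using h by (intro poly_roots_finite) simp
    then have "\<not> 0 islimpt {x. poly (lead_coeff h) x = 0}" by (rule islimpt_finite)
    then have "\<forall>\<^sub>F x in at 0. poly (lead_coeff h) x \<noteq> 0" by (simp add: islimpt_iff_eventually)
    then show ?thesis by (simp add: eventually_at_split)
  qed
  ultimately have "\<forall>\<^sub>F x in at_right 0. (\<forall>L\<in>B. bipoly h x (puiseux_eval (\<gamma> L) x) = 0) \<and>
      (\<forall>L\<in>B. \<forall>L'\<in>B - {L}. branch_quotient f g s (\<gamma> L) x \<noteq> branch_quotient f g s (\<gamma> L') x) \<and>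
      poly (lead_coeff h) x \<noteq> 0"
    by eventually_elim blast
  from eventually_happens'[OF trivial_limit_at_right_real this]
  obtain x where x: "\<forall>L\<in>B. bipoly h x (puiseux_eval (\<gamma> L) x) = 0"
      "\<forall>L\<in>B. \<forall>L'\<in>B - {L}. branch_quotient f g s (\<gamma> L) x \<noteq> branch_quotient f g s (\<gamma> L') x"
      "poly (lead_coeff h) x \<noteq> 0"
    by blast
  define p where "p = map_poly (\<lambda>q. poly q x) h"
  have deg: "degree p \<le> degree h" unfolding p_def by (rule map_poly_degree_leq)
  have "coeff p (degree h) \<noteq> 0" using x(3) by (simp add: p_def coeff_map_poly)
  then have "p \<noteq> 0" by auto
  have p: "poly p y = bipoly h x y" for y
  proof -
    have "poly p y = (\<Sum>j\<le>degree h. coeff p j * y ^ j)"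
      unfolding poly_altdef using deg by (intro sum.mono_neutral_left) (auto simp: coeff_eq_0)
    then show ?thesis by (simp add: bipoly_altdef p_def coeff_map_poly)
  qed
  have "inj_on (\<lambda>L. puiseux_eval (\<gamma> L) x) B"
  proof (rule inj_onI, rule ccontr)
    fix L L' assume L: "L \<in> B" "L' \<in> B" "puiseux_eval (\<gamma> L) x = puiseux_eval (\<gamma> L') x" "L \<noteq> L'"
    then have "branch_quotient f g s (\<gamma> L) x = branch_quotient f g s (\<gamma> L') x"
      by (simp add: branch_quotient_def)
    then show False using x(2) L by blast
  qed
  then have "Suc (degree h) = card ((\<lambda>L. puiseux_eval (\<gamma> L) x) ` B)"
    using B(2) by (simp add: card_image)
  also have "\<dots> \<le> card {y. poly p y = 0}"
    using x(1) by (intro card_mono poly_roots_finite \<open>p \<noteq> 0\<close>) (auto simp: p)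
  also have "\<dots> \<le> degree p" using \<open>p \<noteq> 0\<close> by (rule card_poly_roots_bound)
  finally show False using deg by simp
qed

lemma finite_branch_limits:
  assumes g: "isolated_zero g" and J: "jacobian_poly f g \<noteq> 0"
  shows "finite (branch_limits f g)"
proof -
  have "reflect_x (jacobian_poly f g) \<noteq> 0"
  proof
    assume "reflect_x (jacobian_poly f g) = 0"
    then have "coeff (coeff (jacobian_poly f g) j) i = 0" for i j
      using coeff_reflect_x[of "jacobian_poly f g" j i] by simp
    then show False using J by (metis coeff_0 poly_eqI)
  qed
  then show ?thesis
    unfolding branch_limits_def P_minus_def using J
    by (auto intro!: finite_branch_limit_image[OF g])
qed

section \<open>The range of limits: intermediate values and bounds\<close>

definition bipoly_quotient :: "real poly poly \<Rightarrow> real poly poly \<Rightarrow> real \<times> real \<Rightarrow> real" where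
  "bipoly_quotient f g z = bipoly f (fst z) (snd z) / bipoly g (fst z) (snd z)"

text \<open>The definition of the range asks for g to be nonzero at every index, whereas convergence
  to the origin gives this only eventually; dropping the first n0 terms closes the gap.\<close>

lemma range_of_limitsI:
  assumes g: "isolated_zero g" and z: "filterlim z (at (0, 0)) sequentially"
    and L: "(\<lambda>n. ereal (bipoly_quotient f g (z n))) \<longlonglongrightarrow> L"
  shows "L \<in> range_of_limits f g"
proof -
  obtain n0 where n0: "\<And>n. n \<ge> n0 \<Longrightarrow> bipoly g (fst (z n)) (snd (z n)) \<noteq> 0"
    using eventually_compose_filterlim[OF isolated_zero_eventually(2)[OF g] z]
    by (auto simp: eventually_sequentially)
  have "z \<longlonglongrightarrow> (0, 0)" using z by (simp add: filterlim_at)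
  then have "(\<lambda>n. z (n + n0)) \<longlonglongrightarrow> (0, 0)" by (rule LIMSEQ_ignore_initial_segment)
  moreover have "(\<lambda>n. ereal (bipoly_quotient f g (z (n + n0)))) \<longlonglongrightarrow> L"
    using L by (rule LIMSEQ_ignore_initial_segment)
  ultimately show ?thesis
    unfolding range_of_limits_def using n0
    by (intro CollectI exI[of _ "\<lambda>n. fst (z (n + n0))"] exI[of _ "\<lambda>n. snd (z (n + n0))"])
      (simp add: bipoly_quotient_def)
qed

lemma range_of_limitsE:
  assumes g: "isolated_zero g" and "L \<in> range_of_limits f g"
  obtains z where "filterlim z (at (0, 0)) sequentially" "(\<lambda>n. ereal (bipoly_quotient f g (z n))) \<longlonglongrightarrow> L"
proof -
  obtain x y :: "nat \<Rightarrow> real" where xy: "(\<lambda>k. (x k, y k)) \<longlonglongrightarrow> (0, 0)" "\<And>k. bipoly g (x k) (y k) \<noteq> 0"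
    "(\<lambda>k. ereal (bipoly f (x k) (y k) / bipoly g (x k) (y k))) \<longlonglongrightarrow> L"
    using assms(2) unfolding range_of_limits_def by blast
  have "(x k, y k) \<noteq> (0, 0)" for k
    using xy(2)[of k] isolated_zero_eventually(1)[OF g] by auto
  then have "filterlim (\<lambda>k. (x k, y k)) (at (0, 0)) sequentially"
    unfolding filterlim_at using xy(1) by simp
  with xy(3) show ?thesis using that by (simp add: bipoly_quotient_def)
qed

lemma branch_limits_subset_range:
  assumes g: "isolated_zero g"
  shows "branch_limits f g \<subseteq> range_of_limits f g"
proof
  fix M assume "M \<in> branch_limits f g"
  then consider \<gamma> where "M = branch_limit f g 1 \<gamma>" "\<gamma> \<in> P_plus (jacobian_poly f g)"
    | \<gamma> where "M = branch_limit f g (-1) \<gamma>" "\<gamma> \<in> P_plus (reflect_x (jacobian_poly f g))"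
    unfolding branch_limits_def P_minus_def by (elim UnE imageE)
  then obtain s h \<gamma> where s: "s \<noteq> 0" and \<gamma>: "\<gamma> \<in> P_plus h" and M: "M = branch_limit f g s \<gamma>"
    by cases (metis one_neq_zero, metis neg_0_equal_iff_equal one_neq_zero)
  define t :: "nat \<Rightarrow> real" where "t n = inverse (real (Suc n))" for n
  have t: "filterlim t (at_right 0) sequentially"
    unfolding filterlim_at t_def using LIMSEQ_inverse_real_of_nat by simp
  have "t \<longlonglongrightarrow> 0" using t by (simp add: filterlim_at)
  then have st: "(\<lambda>n. s * t n) \<longlonglongrightarrow> 0" by (rule tendsto_mult_right_zero)
  have "(\<lambda>n. puiseux_eval \<gamma> (t n)) \<longlonglongrightarrow> 0"
    by (rule filterlim_compose[OF tendsto_puiseux_eval[OF \<gamma>] t])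
  with st have "(\<lambda>n. (s * t n, puiseux_eval \<gamma> (t n))) \<longlonglongrightarrow> (0, 0)" by (rule tendsto_Pair)
  then have "filterlim (\<lambda>n. (s * t n, puiseux_eval \<gamma> (t n))) (at (0, 0)) sequentially"
    unfolding filterlim_at using s by (simp add: t_def)
  moreover have "(\<lambda>n. ereal (bipoly_quotient f g (s * t n, puiseux_eval \<gamma> (t n)))) \<longlonglongrightarrow> M"
    using filterlim_compose[OF branch_quotient_tendsto[OF g s \<gamma>] t] M
    by (simp add: branch_quotient_def bipoly_quotient_def)
  ultimately show "M \<in> range_of_limits f g" by (rule range_of_limitsI[OF g])
qed

lemma range_of_limits_between:
  assumes g: "isolated_zero g" and "M1 \<in> range_of_limits f g" "M2 \<in> range_of_limits f g"
    and "M1 < L" "L < M2"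
  shows "L \<in> range_of_limits f g"
proof -
  \<comment> \<open>The strict inequalities make L finite even when M1 or M2 is infinite.\<close>
  obtain l where l: "L = ereal l" using assms(4,5) by (cases L) auto
  define q where "q = bipoly_quotient f g"
  obtain z1 where z1: "filterlim z1 (at (0, 0)) sequentially" "(\<lambda>n. ereal (q (z1 n))) \<longlonglongrightarrow> M1"
    using range_of_limitsE[OF g assms(2)] unfolding q_def by blast
  obtain z2 where z2: "filterlim z2 (at (0, 0)) sequentially" "(\<lambda>n. ereal (q (z2 n))) \<longlonglongrightarrow> M2"
    using range_of_limitsE[OF g assms(3)] unfolding q_def by blast
  obtain d where d: "d > 0" "\<And>z. z \<noteq> (0, 0) \<Longrightarrow> dist z (0, 0) < d \<Longrightarrow> bipoly g (fst z) (snd z) \<noteq> 0"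
    using isolated_zero_eventually(2)[OF g] unfolding eventually_at by auto
  \<comment> \<open>The value l is attained exactly in every punctured disc, so the sequence built
    from these points has constant quotient l.\<close>
  have "\<exists>z. z \<noteq> (0, 0) \<and> dist z (0, 0) < e \<and> q z = l" if "e > 0" for e
  proof -
    define A where "A = ball (0, 0) (min d e) - {(0, 0) :: real \<times> real}"
    have in_A: "\<forall>\<^sub>F z in at (0, 0). z \<in> A"
      unfolding A_def using d(1) that by (intro eventually_at_in_open) auto
    have "\<forall>\<^sub>F n in sequentially. q (z1 n) < l"
      using order_tendstoD(2)[OF z1(2) assms(4)] by (simp add: l)
    with eventually_compose_filterlim[OF in_A z1(1)] have "\<forall>\<^sub>F n in sequentially. z1 n \<in> A \<and> q (z1 n) < l"
      by eventually_elim simp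
    from eventually_happens'[OF sequentially_bot this] obtain p1 where p1: "p1 \<in> A" "q p1 < l" by blast
    have "\<forall>\<^sub>F n in sequentially. q (z2 n) > l"
      using order_tendstoD(1)[OF z2(2) assms(5)] by (simp add: l)
    with eventually_compose_filterlim[OF in_A z2(1)] have "\<forall>\<^sub>F n in sequentially. z2 n \<in> A \<and> q (z2 n) > l"
      by eventually_elim simp
    from eventually_happens'[OF sequentially_bot this] obtain p2 where p2: "p2 \<in> A" "q p2 > l" by blast
    have "connected A"
      unfolding A_def by (rule connected_punctured_ball) simp
    moreover have "continuous_on A q"
      unfolding q_def bipoly_quotient_def
      by (intro continuous_on_divide continuous_on_bipoly) (use d(2) in \<open>auto simp: A_def dist_commute\<close>)
    ultimately have "connected (q ` A)" by (intro connected_continuous_image)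
    then have "{q p1..q p2} \<subseteq> q ` A"
      using p1 p2 by (intro connected_contains_Icc) auto
    then have "l \<in> q ` A" using p1 p2 by auto
    then obtain p where "p \<in> A" "q p = l" by blast
    then show ?thesis by (intro exI[of _ p]) (auto simp: A_def dist_commute)
  qed
  then obtain Z where Z: "\<And>e. e > 0 \<Longrightarrow> Z e \<noteq> (0, 0) \<and> dist (Z e) (0, 0) < e \<and> q (Z e) = l"
    by metis
  define z where "z n = Z (inverse (real (Suc n)))" for n
  have zZ: "z n \<noteq> (0, 0)" "dist (z n) (0, 0) < inverse (real (Suc n))" "q (z n) = l" for n
    using Z[of "inverse (real (Suc n))"] by (auto simp: z_def)
  have "(\<lambda>n. dist (z n) (0, 0)) \<longlonglongrightarrow> 0"
    by (rule tendsto_sandwich[OF _ _ tendsto_const LIMSEQ_inverse_real_of_nat])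
      (use zZ(2) in \<open>auto simp: less_imp_le\<close>)
  then have "z \<longlonglongrightarrow> (0, 0)" by (rule tendsto_dist_iff[THEN iffD2])
  then have "filterlim z (at (0, 0)) sequentially" unfolding filterlim_at using zZ(1) by simp
  then show ?thesis
    by (rule range_of_limitsI[OF g, where f = f]) (use zZ(3) in \<open>simp add: q_def l\<close>)
qed

text \<open>The relation \<open>R\<close> stands for \<open>\<le>\<close> and for \<open>\<ge>\<close>.\<close>

lemma branch_limit_comparison:
  assumes g: "isolated_zero g" and J: "y_regular (jacobian_poly f g)"
    and z: "filterlim z (at (0, 0)) sequentially"
    and R: "\<And>e. e > 0 \<Longrightarrow> \<forall>\<^sub>F z in at (0, 0). \<exists>z'\<in>ball (0, 0) e. bipoly (jacobian_poly f g) (fst z') (snd z') = 0 \<and>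
      bipoly g (fst z') (snd z') \<noteq> 0 \<and> R (bipoly_quotient f g z) (bipoly_quotient f g z')"
  obtains M \<sigma> p where "M \<in> branch_limits f g" "filterlim \<sigma> sequentially sequentially" "(\<lambda>n. ereal (p n)) \<longlonglongrightarrow> M"
    "\<And>n. R (bipoly_quotient f g (z (\<sigma> n))) (p n)"
proof -
  \<comment> \<open>The condition \<open>k n \<ge> n\<close> makes k tend to infinity; it need not
    be monotone for limits along z to be compared.\<close>
  have "\<exists>k w. k \<ge> n \<and> w \<in> ball (0, 0) (inverse (real (Suc n))) \<and>
      bipoly (jacobian_poly f g) (fst w) (snd w) = 0 \<and> bipoly g (fst w) (snd w) \<noteq> 0 \<and>
      R (bipoly_quotient f g (z k)) (bipoly_quotient f g w)" for n
  proof -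
    have "\<forall>\<^sub>F k in sequentially. k \<ge> n \<and> (\<exists>w\<in>ball (0, 0) (inverse (real (Suc n))).
        bipoly (jacobian_poly f g) (fst w) (snd w) = 0 \<and> bipoly g (fst w) (snd w) \<noteq> 0 \<and>
        R (bipoly_quotient f g (z k)) (bipoly_quotient f g w))"
      by (intro eventually_conj eventually_ge_at_top eventually_compose_filterlim[OF R z]) simp
    from eventually_happens'[OF sequentially_bot this] show ?thesis by blast
  qed
  then obtain k w where k: "\<And>n. k n \<ge> n" and w: "\<And>n. w n \<in> ball (0, 0) (inverse (real (Suc n)))"
    "\<And>n. bipoly (jacobian_poly f g) (fst (w n)) (snd (w n)) = 0" "\<And>n. bipoly g (fst (w n)) (snd (w n)) \<noteq> 0"
    "\<And>n. R (bipoly_quotient f g (z (k n))) (bipoly_quotient f g (w n))"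
    by metis
  have "(\<lambda>n. dist (w n) (0, 0)) \<longlonglongrightarrow> 0"
    by (rule tendsto_sandwich[OF _ _ tendsto_const LIMSEQ_inverse_real_of_nat])
      (use w(1) in \<open>auto simp: less_imp_le dist_commute\<close>)
  then have "w \<longlonglongrightarrow> (0, 0)" by (rule tendsto_dist_iff[THEN iffD2])
  then have "(\<lambda>n. fst (w n)) \<longlonglongrightarrow> 0" "(\<lambda>n. snd (w n)) \<longlonglongrightarrow> 0"
    using tendsto_fst[of w "(0, 0)"] tendsto_snd[of w "(0, 0)"] by simp_all
  from critical_sequence_branch_limit[OF g J this w(3) w(2)]
  obtain M \<sigma> where M: "M \<in> branch_limits f g" "strict_mono \<sigma>"
    "(\<lambda>n. ereal (bipoly_quotient f g (w (\<sigma> n)))) \<longlonglongrightarrow> M"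
    unfolding bipoly_quotient_def .
  have "filterlim k sequentially sequentially"
    using k by (intro filterlim_at_top_mono[OF filterlim_ident]) auto
  then have "filterlim (\<lambda>n. k (\<sigma> n)) sequentially sequentially"
    using filterlim_compose filterlim_subseq[OF M(2)] by blast
  then show ?thesis using that[OF M(1) _ M(3)] w(4) by blast
qed

text \<open>On a level curve g is a nonzero constant, so f/g increases with f if g > 0 and decreases
  if g < 0. The sign decides which of the two extremal points serves.\<close>

lemma quotient_bounds_at_critical_points:
  assumes g: "isolated_zero g" and e: "e > 0"
  shows "\<forall>\<^sub>F z in at (0, 0). \<exists>z'\<in>ball (0, 0) e. bipoly (jacobian_poly f g) (fst z') (snd z') = 0 \<and>
      bipoly g (fst z') (snd z') \<noteq> 0 \<and> bipoly_quotient f g z \<le> bipoly_quotient f g z'"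
    and "\<forall>\<^sub>F z in at (0, 0). \<exists>z'\<in>ball (0, 0) e. bipoly (jacobian_poly f g) (fst z') (snd z') = 0 \<and>
      bipoly g (fst z') (snd z') \<noteq> 0 \<and> bipoly_quotient f g z \<ge> bipoly_quotient f g z'"
proof -
  define f' g' J where "f' z = bipoly f (fst z) (snd z)" and "g' z = bipoly g (fst z) (snd z)"
    and "J z = bipoly (jacobian_poly f g) (fst z) (snd z)" for z
  note crit = critical_points_on_level_set[OF g e, of f, folded f'_def g'_def J_def]
  have g0: "\<forall>\<^sub>F z in at (0, 0). g' z \<noteq> 0"
    using isolated_zero_eventually(2)[OF g] by (simp add: g'_def)
  from crit g0 have "\<forall>\<^sub>F z in at (0, 0). \<exists>z'\<in>ball (0, 0) e. J z' = 0 \<and> g' z' \<noteq> 0 \<and> f' z / g' z \<le> f' z' / g' z'"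
  proof eventually_elim
    case (elim z)
    then obtain z1 z2 where z12: "z1 \<in> ball (0, 0) e" "z2 \<in> ball (0, 0) e" "J z1 = 0" "J z2 = 0"
      "g' z1 = g' z" "g' z2 = g' z" "f' z1 \<le> f' z" "f' z \<le> f' z2" by blast
    show ?case
    proof (cases "g' z > 0")
      case True
      then show ?thesis using z12 by (intro bexI[of _ z2]) (auto simp: divide_right_mono)
    next
      case False
      then show ?thesis using z12 elim(2) by (intro bexI[of _ z1]) (auto simp: divide_right_mono_neg)
    qed
  qed
  then show "\<forall>\<^sub>F z in at (0, 0). \<exists>z'\<in>ball (0, 0) e. bipoly (jacobian_poly f g) (fst z') (snd z') = 0 \<and>
      bipoly g (fst z') (snd z') \<noteq> 0 \<and> bipoly_quotient f g z \<le> bipoly_quotient f g z'"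
    by (simp add: f'_def g'_def J_def bipoly_quotient_def)
  from crit g0 have "\<forall>\<^sub>F z in at (0, 0). \<exists>z'\<in>ball (0, 0) e. J z' = 0 \<and> g' z' \<noteq> 0 \<and> f' z / g' z \<ge> f' z' / g' z'"
  proof eventually_elim
    case (elim z)
    then obtain z1 z2 where z12: "z1 \<in> ball (0, 0) e" "z2 \<in> ball (0, 0) e" "J z1 = 0" "J z2 = 0"
      "g' z1 = g' z" "g' z2 = g' z" "f' z1 \<le> f' z" "f' z \<le> f' z2" by blast
    show ?case
    proof (cases "g' z > 0")
      case True
      then show ?thesis using z12 by (intro bexI[of _ z1]) (auto simp: divide_right_mono)
    next
      case False
      then show ?thesis using z12 elim(2) by (intro bexI[of _ z2]) (auto simp: divide_right_mono_neg)
    qed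
  qed
  then show "\<forall>\<^sub>F z in at (0, 0). \<exists>z'\<in>ball (0, 0) e. bipoly (jacobian_poly f g) (fst z') (snd z') = 0 \<and>
      bipoly g (fst z') (snd z') \<noteq> 0 \<and> bipoly_quotient f g z \<ge> bipoly_quotient f g z'"
    by (simp add: f'_def g'_def J_def bipoly_quotient_def)
qed

lemma range_of_limits_bounds:
  assumes g: "isolated_zero g" and J: "y_regular (jacobian_poly f g)" and L: "L \<in> range_of_limits f g"
  shows "\<exists>M\<in>branch_limits f g. L \<le> M" "\<exists>M\<in>branch_limits f g. M \<le> L"
proof -
  obtain z where z: "filterlim z (at (0, 0)) sequentially" "(\<lambda>n. ereal (bipoly_quotient f g (z n))) \<longlonglongrightarrow> L"
    using range_of_limitsE[OF g L] .
  obtain M \<sigma> p where M: "M \<in> branch_limits f g" "filterlim \<sigma> sequentially sequentially" "(\<lambda>n. ereal (p n)) \<longlonglongrightarrow> M"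
    "\<And>n. bipoly_quotient f g (z (\<sigma> n)) \<le> p n"
    by (rule branch_limit_comparison[where R = "(\<le>)", OF g J z(1) quotient_bounds_at_critical_points(1)[OF g]]) (assumption, rule that)
  have "L \<le> M"
    by (rule LIMSEQ_le[OF filterlim_compose[OF z(2) M(2)] M(3)]) (use M(4) in auto)
  with M(1) show "\<exists>M\<in>branch_limits f g. L \<le> M" by blast
  obtain M \<sigma> p where M: "M \<in> branch_limits f g" "filterlim \<sigma> sequentially sequentially" "(\<lambda>n. ereal (p n)) \<longlonglongrightarrow> M"
    "\<And>n. bipoly_quotient f g (z (\<sigma> n)) \<ge> p n"
    by (rule branch_limit_comparison[where R = "(\<ge>)", OF g J z(1) quotient_bounds_at_critical_points(2)[OF g]]) (assumption, rule that)
  have "M \<le> L"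
    by (rule LIMSEQ_le[OF M(3) filterlim_compose[OF z(2) M(2)]]) (use M(4) in auto)
  with M(1) show "\<exists>M\<in>branch_limits f g. M \<le> L" by blast
qed

text \<open>That F has a real branch is a consequence of the comparison: any sequence tending to the
  origin is accompanied by critical points, and these lead to a branch.\<close>

lemma branch_limits_nonempty:
  assumes g: "isolated_zero g" and J: "y_regular (jacobian_poly f g)"
  shows "branch_limits f g \<noteq> {}"
proof -
  define z where "z n = (inverse (real (Suc n)), 0::real)" for n
  have "z \<longlonglongrightarrow> (0, 0)"
    unfolding z_def by (intro tendsto_Pair LIMSEQ_inverse_real_of_nat tendsto_const)
  then have z: "filterlim z (at (0, 0)) sequentially"
    unfolding filterlim_at by (simp add: z_def)
  show ?thesis
  proof (rule branch_limit_comparison[where R = "(\<le>)", OF g J z quotient_bounds_at_critical_points(1)[OF g]])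
    show "0 < e" if "0 < e" for e :: real using that .
    show ?thesis if "M \<in> branch_limits f g" for M using that by blast
  qed
qed

lemma range_of_limits_eq:
  assumes g: "isolated_zero g" and J: "y_regular (jacobian_poly f g)"
  shows "range_of_limits f g = {MIN_limit f g .. MAX_limit f g}"
proof -
  have fin: "finite (branch_limits f g)"
    using finite_branch_limits[OF g] J by (simp add: y_regular_def)
  note ne = branch_limits_nonempty[OF g J]
  have "MIN_limit f g \<in> branch_limits f g" "MAX_limit f g \<in> branch_limits f g"
    using fin ne by (simp_all add: MIN_limit_def MAX_limit_def)
  then have in_range: "MIN_limit f g \<in> range_of_limits f g" "MAX_limit f g \<in> range_of_limits f g"
    using branch_limits_subset_range[OF g] by auto
  show ?thesis
  proof
    show "range_of_limits f g \<subseteq> {MIN_limit f g .. MAX_limit f g}"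
    proof
      fix L assume "L \<in> range_of_limits f g"
      then obtain M M' where M: "M \<in> branch_limits f g" "L \<le> M" "M' \<in> branch_limits f g" "M' \<le> L"
        using range_of_limits_bounds[OF g J] by blast
      have "M \<le> MAX_limit f g" "MIN_limit f g \<le> M'"
        unfolding MAX_limit_def MIN_limit_def using fin M by (auto intro: Max_ge Min_le)
      with M show "L \<in> {MIN_limit f g .. MAX_limit f g}" by auto
    qed
    show "{MIN_limit f g .. MAX_limit f g} \<subseteq> range_of_limits f g"
    proof
      fix L assume "L \<in> {MIN_limit f g .. MAX_limit f g}"
      \<comment> \<open>The endpoints are branch limits and so lie in the range already; only values
        strictly between them need connectedness.\<close>
      then have "L = MIN_limit f g \<or> L = MAX_limit f g \<or> MIN_limit f g < L \<and> L < MAX_limit f g"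
        by (simp add: order_le_less) blast
      then show "L \<in> range_of_limits f g"
      proof (elim disjE conjE)
        assume "MIN_limit f g < L" "L < MAX_limit f g"
        then show ?thesis by (rule range_of_limits_between[OF g in_range])
      qed (simp_all add: in_range)
    qed
  qed
qed

text \<open>In the extended reals the limsup and liminf of the quotients along any sequence tending
  to the origin are limits of subsequences, hence elements of the range. Both therefore equal L,
  without any prior bound on the quotient.\<close>

lemma tendsto_of_range_singleton:
  assumes g: "isolated_zero g" and range: "range_of_limits f g = {ereal L}"
  shows "((\<lambda>(x, y). bipoly f x y / bipoly g x y) \<longlongrightarrow> L) (at (0, 0) within S)"
proof -
  have "(bipoly_quotient f g \<longlongrightarrow> L) (at (0, 0))"
    unfolding tendsto_at_iff_sequentially
  proof (intro allI impI)
    fix z :: "nat \<Rightarrow> real \<times> real"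
    assume z: "\<forall>n. z n \<in> UNIV - {(0, 0)}" "z \<longlonglongrightarrow> (0, 0)"
    define u where "u n = ereal (bipoly_quotient f g (z n))" for n
    have zlim: "filterlim z (at (0, 0)) sequentially" unfolding filterlim_at using z by simp
    have subseq: "M = ereal L" if r: "strict_mono r" "(u \<circ> r) \<longlonglongrightarrow> M" for r :: "nat \<Rightarrow> nat" and M
    proof -
      have "(\<lambda>n. ereal (bipoly_quotient f g (z (r n)))) \<longlonglongrightarrow> M"
        using r(2) by (simp add: u_def comp_def)
      with g filterlim_compose[OF zlim filterlim_subseq[OF r(1)]] have "M \<in> range_of_limits f g"
        by (rule range_of_limitsI)
      then show ?thesis using range by simp
    qed
    obtain r_limsup where "strict_mono r_limsup" "(u \<circ> r_limsup) \<longlonglongrightarrow> limsup u"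
      using limsup_subseq_lim[of u] by (elim exE conjE)
    then have "limsup u = ereal L" by (rule subseq)
    moreover
    obtain r_liminf where "strict_mono r_liminf" "(u \<circ> r_liminf) \<longlonglongrightarrow> liminf u"
      using liminf_subseq_lim[of u] by (elim exE conjE)
    then have "liminf u = ereal L" by (rule subseq)
    ultimately have "u \<longlonglongrightarrow> ereal L"
      by (simp add: tendsto_iff_Liminf_eq_Limsup)
    then show "(bipoly_quotient f g \<circ> z) \<longlonglongrightarrow> L" by (simp add: u_def[abs_def] o_def)
  qed
  then have "(bipoly_quotient f g \<longlongrightarrow> L) (at (0, 0) within S)"
    by (rule tendsto_within_subset) simp
  then show ?thesis by (simp add: bipoly_quotient_def[abs_def] case_prod_unfold)
qed

text \<open>\<open>Lim\<close>, \<open>Min\<close> and \<open>Max\<close> are total functions with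
  unspecified values in degenerate cases. The first four conjuncts show that no such case occurs:
  all branch limits exist, and their set is finite and nonempty.\<close>

theorem theorem5p1:
  fixes f g :: "real poly poly"
  assumes "f \<noteq> 0" and "g \<noteq> 0"
    and "isolated_zero g"
    and "y_regular f" and "y_regular g" and "y_regular (jacobian_poly f g)"
  shows "(\<forall>\<gamma> \<in> P_plus (jacobian_poly f g).
            (branch_quotient f g 1 \<gamma> \<longlongrightarrow> branch_limit f g 1 \<gamma>) (at_right 0)) \<and>
         (\<forall>\<gamma> \<in> P_minus (jacobian_poly f g).
            (branch_quotient f g (- 1) \<gamma> \<longlongrightarrow> branch_limit f g (- 1) \<gamma>) (at_right 0)) \<and>
         finite (branch_limits f g) \<and> branch_limits f g \<noteq> {} \<and>
         range_of_limits f g = {MIN_limit f g .. MAX_limit f g} \<and>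
         (\<forall>L :: real. MIN_limit f g = ereal L \<and> MAX_limit f g = ereal L \<longrightarrow>
            ((\<lambda>(x, y). bipoly f x y / bipoly g x y) \<longlongrightarrow> L)
              (at (0, 0) within {(x, y). bipoly g x y \<noteq> 0}))"
proof (intro conjI ballI allI impI)
  show "(branch_quotient f g 1 \<gamma> \<longlongrightarrow> branch_limit f g 1 \<gamma>) (at_right 0)"
    if "\<gamma> \<in> P_plus (jacobian_poly f g)" for \<gamma>
    by (rule branch_quotient_tendsto[OF assms(3) _ that]) simp
  show "(branch_quotient f g (- 1) \<gamma> \<longlongrightarrow> branch_limit f g (- 1) \<gamma>) (at_right 0)"
    if "\<gamma> \<in> P_minus (jacobian_poly f g)" for \<gamma>
    by (rule branch_quotient_tendsto[OF assms(3) _ that[unfolded P_minus_def]]) simp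
  show "finite (branch_limits f g)"
    using finite_branch_limits[OF assms(3)] assms(6) by (simp add: y_regular_def)
  show "branch_limits f g \<noteq> {}"
    using assms(3,6) by (rule branch_limits_nonempty)
  show range: "range_of_limits f g = {MIN_limit f g .. MAX_limit f g}"
    using assms(3,6) by (rule range_of_limits_eq)
  show "((\<lambda>(x, y). bipoly f x y / bipoly g x y) \<longlongrightarrow> L) (at (0, 0) within {(x, y). bipoly g x y \<noteq> 0})"
    if "MIN_limit f g = ereal L \<and> MAX_limit f g = ereal L" for L
    using range that by (intro tendsto_of_range_singleton[OF assms(3)]) simp
qed

end
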